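(* Let $\mathcal{A}$ be an essentially small additive category and $K$ a field. If the category $\mathcal{F}(\mathcal{A};K)$ is locally noetherian, then all the morphism sets of $\mathcal{A}$ are finite.
   Context: $\mathcal{F}(\mathcal{A};K)$ is the abelian category of all functors from $\mathcal{A}$ to $K$-vector spaces. An object is noetherian if every nonempty family of its subobjects has a maximal element; an abelian category is locally noetherian if it is generated by its noetherian objects. *)

theory Defs
  imports "HOL-Algebra.Module" "HOL-Library.FuncSet"
begin

section \<open>Categories and functors\<close>

text \<open>
  The sets \<open>Mor C x y\<close> are not required to be disjoint; a morphism is always considered together
  with its source and target. Hence composition, and the action of a functor on morphisms, take the
  objects involved as arguments: \<open>cmp C x y z g f\<close> is the composite of \<open>f : x \<rightarrow> y\<close> and \<open>g : y \<rightarrow> z\<close>.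
\<close>

record ('o, 'm) category =
  Ob :: "'o set"
  Mor :: "'o \<Rightarrow> 'o \<Rightarrow> 'm set"
  cmp :: "'o \<Rightarrow> 'o \<Rightarrow> 'o \<Rightarrow> 'm \<Rightarrow> 'm \<Rightarrow> 'm"
  ident :: "'o \<Rightarrow> 'm"

definition is_category :: "('o, 'm) category \<Rightarrow> bool" where
  "is_category C \<longleftrightarrow>
     (\<forall>x\<in>Ob C. ident C x \<in> Mor C x x) \<and>
     (\<forall>x\<in>Ob C. \<forall>y\<in>Ob C. \<forall>z\<in>Ob C. \<forall>f\<in>Mor C x y. \<forall>g\<in>Mor C y z. cmp C x y z g f \<in> Mor C x z) \<and>
     (\<forall>x\<in>Ob C. \<forall>y\<in>Ob C. \<forall>f\<in>Mor C x y.
        cmp C x x y f (ident C x) = f \<and> cmp C x y y (ident C y) f = f) \<and>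
     (\<forall>w\<in>Ob C. \<forall>x\<in>Ob C. \<forall>y\<in>Ob C. \<forall>z\<in>Ob C. \<forall>f\<in>Mor C w x. \<forall>g\<in>Mor C x y. \<forall>h\<in>Mor C y z.
        cmp C w y z h (cmp C w x y g f) = cmp C w x z (cmp C x y z h g) f)"

definition is_iso_mor :: "('o, 'm) category \<Rightarrow> 'o \<Rightarrow> 'o \<Rightarrow> 'm \<Rightarrow> bool" where
  "is_iso_mor C x y f \<longleftrightarrow> f \<in> Mor C x y \<and>
     (\<exists>g\<in>Mor C y x. cmp C x y x g f = ident C x \<and> cmp C y x y f g = ident C y)"

definition is_mono :: "('o, 'm) category \<Rightarrow> 'o \<Rightarrow> 'o \<Rightarrow> 'm \<Rightarrow> bool" where
  "is_mono C x y f \<longleftrightarrow> f \<in> Mor C x y \<and>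
     (\<forall>w\<in>Ob C. \<forall>g\<in>Mor C w x. \<forall>h\<in>Mor C w x. cmp C w x y f g = cmp C w x y f h \<longrightarrow> g = h)"

record ('o, 'm, 'p, 'n) cat_functor =
  omap :: "'o \<Rightarrow> 'p"
  mmap :: "'o \<Rightarrow> 'o \<Rightarrow> 'm \<Rightarrow> 'n"

definition is_functor ::
  "('o, 'm) category \<Rightarrow> ('p, 'n) category \<Rightarrow> ('o, 'm, 'p, 'n) cat_functor \<Rightarrow> bool" where
  "is_functor C D F \<longleftrightarrow>
     (\<forall>x\<in>Ob C. omap F x \<in> Ob D) \<and>
     (\<forall>x\<in>Ob C. \<forall>y\<in>Ob C. \<forall>f\<in>Mor C x y. mmap F x y f \<in> Mor D (omap F x) (omap F y)) \<and>
     (\<forall>x\<in>Ob C. mmap F x x (ident C x) = ident D (omap F x)) \<and>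
     (\<forall>x\<in>Ob C. \<forall>y\<in>Ob C. \<forall>z\<in>Ob C. \<forall>f\<in>Mor C x y. \<forall>g\<in>Mor C y z.
        mmap F x z (cmp C x y z g f) =
        cmp D (omap F x) (omap F y) (omap F z) (mmap F y z g) (mmap F x y f))"

definition is_equivalence ::
  "('o, 'm) category \<Rightarrow> ('p, 'n) category \<Rightarrow> ('o, 'm, 'p, 'n) cat_functor \<Rightarrow> bool" where
  "is_equivalence C D F \<longleftrightarrow> is_functor C D F \<and>
     (\<forall>x\<in>Ob C. \<forall>y\<in>Ob C. bij_betw (mmap F x y) (Mor C x y) (Mor D (omap F x) (omap F y))) \<and>
     (\<forall>d\<in>Ob D. \<exists>x\<in>Ob C. \<exists>f. is_iso_mor D (omap F x) d f)"

text \<open>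
  Natural transformations are extensional families (arbitrary outside \<open>Ob C\<close> would spoil equality
  of morphisms). Functors are not required to be extensional: functors that agree on \<open>C\<close> but differ
  outside it are distinct, isomorphic objects.
\<close>

definition nat_trans ::
  "('o, 'm) category \<Rightarrow> ('p, 'n) category \<Rightarrow>
   ('o, 'm, 'p, 'n) cat_functor \<Rightarrow> ('o, 'm, 'p, 'n) cat_functor \<Rightarrow> ('o \<Rightarrow> 'n) set" where
  "nat_trans C D F G =
     {\<eta> \<in> (\<Pi>\<^sub>E x\<in>Ob C. Mor D (omap F x) (omap G x)).
        \<forall>x\<in>Ob C. \<forall>y\<in>Ob C. \<forall>f\<in>Mor C x y.
          cmp D (omap F x) (omap F y) (omap G y) (\<eta> y) (mmap F x y f) =
          cmp D (omap F x) (omap G x) (omap G y) (mmap G x y f) (\<eta> x)}"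

definition functor_category ::
  "('o, 'm) category \<Rightarrow> ('p, 'n) category \<Rightarrow>
   (('o, 'm, 'p, 'n) cat_functor, 'o \<Rightarrow> 'n) category" where
  "functor_category C D =
     \<lparr>Ob = {F. is_functor C D F},
      Mor = nat_trans C D,
      cmp = (\<lambda>F G H \<epsilon> \<eta>. \<lambda>x\<in>Ob C. cmp D (omap F x) (omap G x) (omap H x) (\<epsilon> x) (\<eta> x)),
      ident = (\<lambda>F. \<lambda>x\<in>Ob C. ident D (omap F x))\<rparr>"


section \<open>Essentially small additive categories\<close>

text \<open>
  A type \<open>'u\<close> plays the role of the universe. Small categories are those whose objects and morphisms
  are elements of \<open>'u\<close>; the category itself may have objects and morphisms of any types.
\<close>

definition essentially_small :: "'u itself \<Rightarrow> ('o, 'm) category \<Rightarrow> bool" where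
  "essentially_small _ C \<longleftrightarrow>
     (\<exists>(D :: ('u, 'u) category) F. is_category D \<and> is_equivalence C D F)"

definition is_preadditive ::
  "('o, 'm) category \<Rightarrow> ('o \<Rightarrow> 'o \<Rightarrow> 'm \<Rightarrow> 'm \<Rightarrow> 'm) \<Rightarrow> ('o \<Rightarrow> 'o \<Rightarrow> 'm) \<Rightarrow> bool" where
  "is_preadditive C pl nul \<longleftrightarrow> is_category C \<and>
     (\<forall>x\<in>Ob C. \<forall>y\<in>Ob C. comm_group \<lparr>carrier = Mor C x y, mult = pl x y, one = nul x y\<rparr>) \<and>
     (\<forall>x\<in>Ob C. \<forall>y\<in>Ob C. \<forall>z\<in>Ob C. \<forall>f\<in>Mor C x y. \<forall>f'\<in>Mor C x y. \<forall>g\<in>Mor C y z. \<forall>g'\<in>Mor C y z.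
        cmp C x y z g (pl x y f f') = pl x z (cmp C x y z g f) (cmp C x y z g f') \<and>
        cmp C x y z (pl y z g g') f = pl x z (cmp C x y z g f) (cmp C x y z g' f))"

definition is_zero_object :: "('o, 'm) category \<Rightarrow> 'o \<Rightarrow> bool" where
  "is_zero_object C z \<longleftrightarrow> z \<in> Ob C \<and>
     (\<forall>x\<in>Ob C. (\<exists>!f. f \<in> Mor C z x) \<and> (\<exists>!f. f \<in> Mor C x z))"

text \<open>Biproduct diagrams \<open>x \<leftrightarrows> s \<leftrightarrows> y\<close>; the relations \<open>p j = 0\<close> and \<open>q i = 0\<close> follow from these.\<close>

definition is_biproduct ::
  "('o, 'm) category \<Rightarrow> ('o \<Rightarrow> 'o \<Rightarrow> 'm \<Rightarrow> 'm \<Rightarrow> 'm) \<Rightarrow>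
   'o \<Rightarrow> 'o \<Rightarrow> 'o \<Rightarrow> 'm \<Rightarrow> 'm \<Rightarrow> 'm \<Rightarrow> 'm \<Rightarrow> bool" where
  "is_biproduct C pl x y s i j p q \<longleftrightarrow> s \<in> Ob C \<and>
     i \<in> Mor C x s \<and> j \<in> Mor C y s \<and> p \<in> Mor C s x \<and> q \<in> Mor C s y \<and>
     cmp C x s x p i = ident C x \<and> cmp C y s y q j = ident C y \<and>
     pl s s (cmp C s x s i p) (cmp C s y s j q) = ident C s"

definition is_additive :: "('o, 'm) category \<Rightarrow> bool" where
  "is_additive C \<longleftrightarrow> (\<exists>pl nul. is_preadditive C pl nul \<and>
     (\<exists>z. is_zero_object C z) \<and>
     (\<forall>x\<in>Ob C. \<forall>y\<in>Ob C. \<exists>s i j p q. is_biproduct C pl x y s i j p q))"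


section \<open>Locally noetherian categories\<close>

text \<open>
  Subobjects of \<open>x\<close> are represented by monomorphisms \<open>(s, m)\<close> with target \<open>x\<close>, preordered by
  factorisation; two of them define the same subobject if each factors through the other. Therefore
  \<open>(s, m)\<close> is maximal in a family if it lies above every member which lies above it.
\<close>

definition subobjects :: "('o, 'm) category \<Rightarrow> 'o \<Rightarrow> ('o \<times> 'm) set" where
  "subobjects C x = {(s, m). s \<in> Ob C \<and> is_mono C s x m}"

definition factors_through ::
  "('o, 'm) category \<Rightarrow> 'o \<Rightarrow> 'o \<times> 'm \<Rightarrow> 'o \<times> 'm \<Rightarrow> bool" where
  "factors_through C x = (\<lambda>(s, f) (t, m). \<exists>h\<in>Mor C s t. cmp C s t x m h = f)"

definition noetherian_object :: "('o, 'm) category \<Rightarrow> 'o \<Rightarrow> bool" where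
  "noetherian_object C x \<longleftrightarrow> x \<in> Ob C \<and>
     (\<forall>\<F>. \<F> \<subseteq> subobjects C x \<and> \<F> \<noteq> {} \<longrightarrow>
        (\<exists>S\<in>\<F>. \<forall>T\<in>\<F>. factors_through C x S T \<longrightarrow> factors_through C x T S))"

text \<open>
  Grothendieck's definition of a family of generators of an abelian category: for every proper
  subobject of \<open>x\<close> there is a morphism from a member of the family to \<open>x\<close> which does not factor
  through it.
\<close>

definition generates :: "'o set \<Rightarrow> ('o, 'm) category \<Rightarrow> bool" where
  "generates \<G> C \<longleftrightarrow> \<G> \<subseteq> Ob C \<and>
     (\<forall>x\<in>Ob C. \<forall>(s, m)\<in>subobjects C x. \<not> is_iso_mor C s x m \<longrightarrow>
        (\<exists>g\<in>\<G>. \<exists>f\<in>Mor C g x. \<not> factors_through C x (g, f) (s, m)))"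

definition locally_noetherian :: "('o, 'm) category \<Rightarrow> bool" where
  "locally_noetherian C \<longleftrightarrow> generates {x. noetherian_object C x} C"


section \<open>Functors to vector spaces\<close>

text \<open>
  The field and the vector spaces belong to the universe \<open>'u\<close>, that is, their elements are elements
  of \<open>'u\<close>. The fields \<open>mult\<close> and \<open>one\<close>, which the record type of modules inherits from that of rings,
  are irrelevant; again they only produce isomorphic copies of objects.
\<close>

definition linear_maps ::
  "'u ring \<Rightarrow> ('u, 'u) module \<Rightarrow> ('u, 'u) module \<Rightarrow> ('u \<Rightarrow> 'u) set" where
  "linear_maps K V W =
     {f \<in> carrier V \<rightarrow>\<^sub>E carrier W.
        (\<forall>v\<in>carrier V. \<forall>w\<in>carrier V. f (v \<oplus>\<^bsub>V\<^esub> w) = f v \<oplus>\<^bsub>W\<^esub> f w) \<and>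
        (\<forall>a\<in>carrier K. \<forall>v\<in>carrier V. f (a \<odot>\<^bsub>V\<^esub> v) = a \<odot>\<^bsub>W\<^esub> f v)}"

definition Vect :: "'u ring \<Rightarrow> (('u, 'u) module, 'u \<Rightarrow> 'u) category" where
  "Vect K =
     \<lparr>Ob = {V. module K V},
      Mor = linear_maps K,
      cmp = (\<lambda>U V W g f. compose (carrier U) g f),
      ident = (\<lambda>V. \<lambda>v\<in>carrier V. v)\<rparr>"

text \<open>
  The category of all functors from \<open>A\<close> to \<open>K\<close>-vector spaces. If \<open>'u\<close> is infinite and \<open>A\<close> is
  essentially small with respect to \<open>'u\<close>, then the functors \<open>K[A(a,-)]\<close> and all their quotients have
  isomorphic copies with values in \<open>'u\<close>. As these functors are projective generators, whether the
  category is locally noetherian does not depend on \<open>'u\<close>. If \<open>'u\<close> is finite, then so are the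
  morphism sets of \<open>A\<close>.
\<close>

definition functors_to_Vect ::
  "('o, 'm) category \<Rightarrow> 'u ring \<Rightarrow>
   (('o, 'm, ('u, 'u) module, 'u \<Rightarrow> 'u) cat_functor, 'o \<Rightarrow> 'u \<Rightarrow> 'u) category" where
  "functors_to_Vect A K = functor_category A (Vect K)"

end

theory Submission
  imports Defs "HOL-Algebra.Free_Abelian_Groups"
begin

text \<open>
  Let \<open>s\<close> be the biproduct of \<open>x\<close> and \<open>y\<close>. The functor \<open>K[A(s,-)]\<close> is generated by the identity of
  \<open>s\<close>. If the category of functors is locally noetherian, then every functor generated by one
  element satisfies the ascending chain condition on subfunctors (lemma \<open>cyclic_functor_chain\<close>): it
  is the sum of the images of noetherian objects, the generator already lies in the sum of finitely
  many of them, and finite sums of noetherian subobjects are noetherian. A subfunctor \<open>U\<close> of the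
  set-valued functor \<open>A(s,-)\<close> can be recovered from the subfunctor \<open>K[U]\<close> of \<open>K[A(s,-)]\<close>, so the
  ascending chain condition holds for \<open>A(s,-)\<close> as well (lemma \<open>set_subfunctor_chain\<close>).

  By the universal property of \<open>s\<close> as a coproduct (lemma \<open>biproduct_copairing\<close>), an element of
  \<open>A(s,t)\<close> is a pair of morphisms \<open>x \<rightarrow> t\<close> and \<open>y \<rightarrow> t\<close>. Each \<open>g : y \<rightarrow> x\<close> has a graph, the
  subfunctor of all pairs \<open>(u, u g)\<close> with \<open>u : x \<rightarrow> t\<close>. It is generated by \<open>(1, g)\<close>, and \<open>(1, g)\<close>
  lies in the graph of \<open>g'\<close> only if \<open>g = g'\<close>. If there were infinitely many morphisms \<open>y \<rightarrow> x\<close>, then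
  the unions of the first \<open>n\<close> members of an infinite sequence of graphs would form a strictly
  increasing chain. So \<open>A(y,x)\<close> is finite.

  To build \<open>K[A(s,-)]\<close> inside the universe \<open>'u\<close>, the free vector space on a set is realised as the
  span of the Dirac measures among the \<open>K\<close>-valued functions on the power set. The action of a
  morphism is then the pushforward of measures, which involves no summation over fibres, and the
  structure is transported along an injection of this span into \<open>'u\<close>. Such an injection exists
  because \<open>'u\<close> is infinite if some morphism set is.
\<close>

section \<open>Subfunctors\<close>

locale functors_to_vector_spaces =
  fixes A :: "('o, 'm) category" and K :: "'u ring"
  assumes category: "is_category A"
    and field: "field K"
begin

lemma cring_K: "cring K"
  using field by (simp add: field_def domain_def)

abbreviation FA :: "(('o, 'm, ('u, 'u) module, 'u \<Rightarrow> 'u) cat_functor, 'o \<Rightarrow> 'u \<Rightarrow> 'u) category"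
  where "FA \<equiv> functors_to_Vect A K"

lemma Ob_FA: "X \<in> Ob FA \<longleftrightarrow> is_functor A (Vect K) X"
  by (simp add: functors_to_Vect_def functor_category_def)

lemma module_value:
  assumes "X \<in> Ob FA" "t \<in> Ob A"
  shows "module K (omap X t)"
  using assms by (simp add: Ob_FA is_functor_def Vect_def)

lemma mmap_linear:
  assumes "X \<in> Ob FA" "t \<in> Ob A" "t' \<in> Ob A" "u \<in> Mor A t t'"
  shows "mmap X t t' u \<in> linear_maps K (omap X t) (omap X t')"
  using assms by (simp add: Ob_FA is_functor_def Vect_def)

lemma component_linear:
  assumes "\<eta> \<in> Mor FA X Y" "t \<in> Ob A"
  shows "\<eta> t \<in> linear_maps K (omap X t) (omap Y t)"
  using assms by (auto simp: functors_to_Vect_def functor_category_def nat_trans_def Vect_def)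

lemma component_natural:
  assumes "\<eta> \<in> Mor FA X Y" "t \<in> Ob A" "t' \<in> Ob A" "u \<in> Mor A t t'" "v \<in> carrier (omap X t)"
  shows "\<eta> t' (mmap X t t' u v) = mmap Y t t' u (\<eta> t v)"
proof -
  have "compose (carrier (omap X t)) (\<eta> t') (mmap X t t' u)
      = compose (carrier (omap X t)) (mmap Y t t' u) (\<eta> t)"
    using assms by (auto simp: functors_to_Vect_def functor_category_def nat_trans_def Vect_def)
  from fun_cong[OF this, of v] show ?thesis
    using assms by (simp add: compose_def)
qed

lemma cmp_FA:
  "cmp FA F G H \<epsilon> \<eta> = (\<lambda>t\<in>Ob A. compose (carrier (omap F t)) (\<epsilon> t) (\<eta> t))"
  by (simp add: functors_to_Vect_def functor_category_def Vect_def)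

lemma ident_FA: "ident FA F = (\<lambda>t\<in>Ob A. \<lambda>v\<in>carrier (omap F t). v)"
  by (simp add: functors_to_Vect_def functor_category_def Vect_def)

lemma linear_mapsD:
  assumes "f \<in> linear_maps K V W"
  shows "v \<in> carrier V \<Longrightarrow> f v \<in> carrier W"
    and "v \<in> carrier V \<Longrightarrow> w \<in> carrier V \<Longrightarrow> f (v \<oplus>\<^bsub>V\<^esub> w) = f v \<oplus>\<^bsub>W\<^esub> f w"
    and "a \<in> carrier K \<Longrightarrow> v \<in> carrier V \<Longrightarrow> f (a \<odot>\<^bsub>V\<^esub> v) = a \<odot>\<^bsub>W\<^esub> f v"
    and "v \<notin> carrier V \<Longrightarrow> f v = undefined"
  using assms by (auto simp: linear_maps_def)

text \<open>Negation is scaling by \<open>-1\<close>, so closure under it follows from the other conditions.\<close>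

lemma submoduleI':
  assumes M: "module K V" and "H \<subseteq> carrier V" "\<zero>\<^bsub>V\<^esub> \<in> H"
    and "\<And>a b. a \<in> H \<Longrightarrow> b \<in> H \<Longrightarrow> a \<oplus>\<^bsub>V\<^esub> b \<in> H"
    and sm: "\<And>k a. k \<in> carrier K \<Longrightarrow> a \<in> H \<Longrightarrow> k \<odot>\<^bsub>V\<^esub> a \<in> H"
  shows "submodule H K V"
proof -
  interpret V: module K V by fact
  have "\<ominus>\<^bsub>V\<^esub> a \<in> H" if "a \<in> H" for a
    using sm[of "\<ominus>\<^bsub>K\<^esub> \<one>\<^bsub>K\<^esub>" a] that assms(2) by (auto simp: V.smult_l_minus)
  then show ?thesis
    using assms by (intro V.submoduleI) auto
qed

lemma submoduleD:
  assumes "module K V" "submodule H K V"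
  shows "a \<in> H \<Longrightarrow> a \<in> carrier V" "\<zero>\<^bsub>V\<^esub> \<in> H"
    and "a \<in> H \<Longrightarrow> b \<in> H \<Longrightarrow> a \<oplus>\<^bsub>V\<^esub> b \<in> H"
    and "a \<in> H \<Longrightarrow> \<ominus>\<^bsub>V\<^esub> a \<in> H"
    and "k \<in> carrier K \<Longrightarrow> a \<in> H \<Longrightarrow> k \<odot>\<^bsub>V\<^esub> a \<in> H"
  using module.submoduleE[OF assms] subgroup.one_closed[OF submodule.axioms(1)[OF assms(2)]]
  by auto

lemma linear_map_zero:
  assumes "module K V" "module K W" "f \<in> linear_maps K V W"
  shows "f \<zero>\<^bsub>V\<^esub> = \<zero>\<^bsub>W\<^esub>"
proof -
  interpret V: module K V by fact
  interpret W: module K W by fact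
  have "f (\<zero>\<^bsub>K\<^esub> \<odot>\<^bsub>V\<^esub> \<zero>\<^bsub>V\<^esub>) = \<zero>\<^bsub>K\<^esub> \<odot>\<^bsub>W\<^esub> f \<zero>\<^bsub>V\<^esub>"
    by (rule linear_mapsD(3)[OF assms(3)]) auto
  then show ?thesis
    using linear_mapsD(1)[OF assms(3)] by simp
qed

text \<open>
  Subobjects of a functor are handled as families of subspaces stable under the action of \<open>A\<close>. The
  passage back to monomorphisms of the functor category is \<open>restriction\<close> together with \<open>inclusion\<close>.
\<close>

definition subfunctor :: "('o, 'm, ('u, 'u) module, 'u \<Rightarrow> 'u) cat_functor \<Rightarrow> ('o \<Rightarrow> 'u set) \<Rightarrow> bool" where
  "subfunctor X N \<longleftrightarrow>
     (\<forall>t\<in>Ob A. submodule (N t) K (omap X t)) \<and>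
     (\<forall>t\<in>Ob A. \<forall>t'\<in>Ob A. \<forall>u\<in>Mor A t t'. \<forall>v\<in>N t. mmap X t t' u v \<in> N t')"

definition restriction where
  "restriction X N =
     \<lparr>omap = (\<lambda>t. (omap X t)\<lparr>carrier := N t\<rparr>),
      mmap = (\<lambda>t t' u. restrict (mmap X t t' u) (N t))\<rparr>"

definition inclusion :: "('o \<Rightarrow> 'u set) \<Rightarrow> 'o \<Rightarrow> 'u \<Rightarrow> 'u" where
  "inclusion N = (\<lambda>t\<in>Ob A. \<lambda>v\<in>N t. v)"

lemma subfunctorD:
  assumes "subfunctor X N" "t \<in> Ob A"
  shows "submodule (N t) K (omap X t)"
    and "t' \<in> Ob A \<Longrightarrow> u \<in> Mor A t t' \<Longrightarrow> v \<in> N t \<Longrightarrow> mmap X t t' u v \<in> N t'"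
  using assms by (auto simp: subfunctor_def)

lemma subfunctor_carrier:
  assumes "X \<in> Ob FA" "subfunctor X N" "t \<in> Ob A" "v \<in> N t"
  shows "v \<in> carrier (omap X t)"
  using submoduleD(1)[OF module_value[OF assms(1,3)] subfunctorD(1)[OF assms(2,3)]] assms(4) .

lemma restriction_Ob:
  assumes X: "X \<in> Ob FA" and N: "subfunctor X N"
  shows "restriction X N \<in> Ob FA"
proof -
  note c = subfunctor_carrier[OF X N]
  have F: "is_functor A (Vect K) X" using X by (simp add: Ob_FA)
  have 1: "module K ((omap X t)\<lparr>carrier := N t\<rparr>)" if "t \<in> Ob A" for t
    using submodule.submodule_is_module[OF subfunctorD(1)[OF N that] module_value[OF X that]] .
  have 2: "restrict (mmap X t t' u) (N t)
      \<in> linear_maps K ((omap X t)\<lparr>carrier := N t\<rparr>) ((omap X t')\<lparr>carrier := N t'\<rparr>)"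
    if t: "t \<in> Ob A" "t' \<in> Ob A" "u \<in> Mor A t t'" for t t' u
    using subfunctorD[OF N t(1)] linear_mapsD[OF mmap_linear[OF X t]] c[OF t(1)] t
      submoduleD[OF module_value[OF X t(1)] subfunctorD(1)[OF N t(1)]]
    by (auto simp: linear_maps_def)
  have 3: "restrict (mmap X t t (ident A t)) (N t) = (\<lambda>v\<in>N t. v)" if "t \<in> Ob A" for t
  proof -
    have "mmap X t t (ident A t) = (\<lambda>v\<in>carrier (omap X t). v)"
      using F that by (simp add: is_functor_def Vect_def)
    then show ?thesis using c that by (auto simp: fun_eq_iff restrict_def)
  qed
  have 4: "restrict (mmap X x z (cmp A x y z g f)) (N x)
      = compose (N x) (restrict (mmap X y z g) (N y)) (restrict (mmap X x y f) (N x))"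
    if "x \<in> Ob A" "y \<in> Ob A" "z \<in> Ob A" "f \<in> Mor A x y" "g \<in> Mor A y z" for x y z f g
  proof -
    have "mmap X x z (cmp A x y z g f) = compose (carrier (omap X x)) (mmap X y z g) (mmap X x y f)"
      using F that by (simp add: is_functor_def Vect_def)
    then show ?thesis
      using c that subfunctorD(2)[OF N] by (auto simp: fun_eq_iff restrict_def compose_def)
  qed
  show ?thesis
    using 1 2 3 4 by (simp add: Ob_FA is_functor_def Vect_def restriction_def)
qed

lemma corestriction_Mor:
  assumes X: "X \<in> Ob FA" and N: "subfunctor X N" and f: "f \<in> Mor FA G X"
    and im: "\<And>t v. t \<in> Ob A \<Longrightarrow> v \<in> carrier (omap G t) \<Longrightarrow> f t v \<in> N t"
  shows "f \<in> Mor FA G (restriction X N)"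
proof -
  have "f \<in> extensional (Ob A)"
    using f by (auto simp: functors_to_Vect_def functor_category_def nat_trans_def PiE_def)
  moreover have "f t \<in> linear_maps K (omap G t) ((omap X t)\<lparr>carrier := N t\<rparr>)" if "t \<in> Ob A" for t
    using component_linear[OF f that] im[OF that] by (auto simp: linear_maps_def PiE_def)
  moreover have "compose (carrier (omap G t)) (f t') (mmap G t t' u)
      = compose (carrier (omap G t)) (restrict (mmap X t t' u) (N t)) (f t)"
    if "t \<in> Ob A" "t' \<in> Ob A" "u \<in> Mor A t t'" for t t' u
    using component_natural[OF f that] im that by (auto simp: compose_def fun_eq_iff)
  ultimately show ?thesis
    by (auto simp: functors_to_Vect_def functor_category_def nat_trans_def Vect_def restriction_def
        PiE_def)
qed

lemma inclusion_Mor: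
  assumes X: "X \<in> Ob FA" and N: "subfunctor X N"
  shows "inclusion N \<in> Mor FA (restriction X N) X"
proof -
  have "inclusion N t \<in> linear_maps K ((omap X t)\<lparr>carrier := N t\<rparr>) (omap X t)" if t: "t \<in> Ob A" for t
    using t submoduleD[OF module_value[OF X t] subfunctorD(1)[OF N t]]
    by (auto simp: linear_maps_def inclusion_def)
  then show ?thesis
    using subfunctorD(2)[OF N]
    by (auto simp: functors_to_Vect_def functor_category_def nat_trans_def Vect_def restriction_def
        inclusion_def compose_def fun_eq_iff)
qed

text \<open>
  Factorisation through a subfunctor is a pointwise condition. This turns the conditions
  \<open>generates\<close> and \<open>noetherian_object\<close> into statements about elements.
\<close>

lemma factors_through_inclusion_iff:
  assumes X: "X \<in> Ob FA" and N: "subfunctor X N" and f: "f \<in> Mor FA G X"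
  shows "factors_through FA X (G, f) (restriction X N, inclusion N) \<longleftrightarrow>
     (\<forall>t\<in>Ob A. \<forall>v\<in>carrier (omap G t). f t v \<in> N t)"
proof
  assume "factors_through FA X (G, f) (restriction X N, inclusion N)"
  then obtain h where h: "h \<in> Mor FA G (restriction X N)"
    and eq: "cmp FA G (restriction X N) X (inclusion N) h = f"
    by (auto simp: factors_through_def)
  have "f t v \<in> N t" if t: "t \<in> Ob A" "v \<in> carrier (omap G t)" for t v
  proof -
    have "h t v \<in> N t"
      using linear_mapsD(1)[OF component_linear[OF h t(1)] t(2)] by (simp add: restriction_def)
    moreover have "f t v = inclusion N t (h t v)"
      using t by (simp add: eq[symmetric] cmp_FA compose_def)
    ultimately show ?thesis using t by (simp add: inclusion_def)
  qed
  then show "\<forall>t\<in>Ob A. \<forall>v\<in>carrier (omap G t). f t v \<in> N t" by blast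
next
  assume im: "\<forall>t\<in>Ob A. \<forall>v\<in>carrier (omap G t). f t v \<in> N t"
  have ext: "f \<in> extensional (Ob A)"
    using f by (auto simp: functors_to_Vect_def functor_category_def nat_trans_def PiE_def)
  have "cmp FA G (restriction X N) X (inclusion N) f t v = f t v" for t v
  proof (cases "t \<in> Ob A")
    case True
    then show ?thesis
      using im linear_mapsD(4)[OF component_linear[OF f True]]
      by (auto simp: cmp_FA compose_def inclusion_def)
  next
    case False
    then show ?thesis using ext by (simp add: cmp_FA extensional_def)
  qed
  then show "factors_through FA X (G, f) (restriction X N, inclusion N)"
    using corestriction_Mor[OF X N f] im by (auto simp: factors_through_def fun_eq_iff)
qed

lemma inclusion_subobject:
  assumes X: "X \<in> Ob FA" and N: "subfunctor X N"
  shows "(restriction X N, inclusion N) \<in> subobjects FA X"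
proof -
  have "g = h" if g: "g \<in> Mor FA W (restriction X N)" and h: "h \<in> Mor FA W (restriction X N)"
    and eq: "cmp FA W (restriction X N) X (inclusion N) g = cmp FA W (restriction X N) X (inclusion N) h"
    for W g h
  proof (intro ext)
    fix t v
    show "g t v = h t v"
    proof (cases "t \<in> Ob A")
      case False
      then show ?thesis using g h
        by (auto simp: functors_to_Vect_def functor_category_def nat_trans_def PiE_def extensional_def)
    next
      case t: True
      note gh = component_linear[OF g t] component_linear[OF h t]
      show ?thesis
      proof (cases "v \<in> carrier (omap W t)")
        case True
        then have "g t v \<in> N t" "h t v \<in> N t"
          using gh[THEN linear_mapsD(1)] by (simp_all add: restriction_def)
        then show ?thesis
          using fun_cong[OF fun_cong[OF eq], of t v] t True
          by (simp add: cmp_FA compose_def inclusion_def)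
      qed (use gh[THEN linear_mapsD(4)] in auto)
    qed
  qed
  then show ?thesis
    using restriction_Ob[OF X N] inclusion_Mor[OF X N] by (auto simp: subobjects_def is_mono_def)
qed

section \<open>Ascending chains of subfunctors\<close>

definition chain_of_subfunctors ::
    "('o, 'm, ('u, 'u) module, 'u \<Rightarrow> 'u) cat_functor \<Rightarrow> (nat \<Rightarrow> 'o \<Rightarrow> 'u set) \<Rightarrow> bool" where
  "chain_of_subfunctors X N \<longleftrightarrow>
     (\<forall>n. subfunctor X (N n)) \<and> (\<forall>m n t. m \<le> n \<longrightarrow> t \<in> Ob A \<longrightarrow> N m t \<subseteq> N n t)"

text \<open>
  For a subfunctor \<open>B\<close> this says that \<open>B\<close> is noetherian, but the chains run through subfunctors of
  the ambient functor \<open>X\<close> and are cut down to \<open>B\<close>. In this form sums are easier to treat, since all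
  chains that occur consist of subfunctors of one and the same \<open>X\<close>. As the chains ascend, all
  members from the \<open>n\<close>-th one on have the same intersection with \<open>B\<close>.
\<close>

definition chains_stabilise_on where
  "chains_stabilise_on X B \<longleftrightarrow>
     (\<forall>N. chain_of_subfunctors X N \<longrightarrow> (\<exists>n. \<forall>m. \<forall>t\<in>Ob A. N m t \<inter> B t \<subseteq> N n t))"

text \<open>
  A maximal element of the family of all members of the chain is a member at which it stabilises.
\<close>

lemma noetherian_chain:
  assumes X: "noetherian_object FA X" and N: "chain_of_subfunctors X N"
  shows "\<exists>n. \<forall>m. \<forall>t\<in>Ob A. N m t \<subseteq> N n t"
proof -
  have XO: "X \<in> Ob FA" using X by (simp add: noetherian_object_def)
  have sub: "subfunctor X (N n)" for n using N by (simp add: chain_of_subfunctors_def)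
  let ?S = "\<lambda>n. (restriction X (N n), inclusion (N n))"
  have le: "factors_through FA X (?S m) (?S n) \<longleftrightarrow> (\<forall>t\<in>Ob A. N m t \<subseteq> N n t)" for m n
    by (subst factors_through_inclusion_iff[OF XO sub inclusion_Mor[OF XO sub]])
       (auto simp: restriction_def inclusion_def)
  have "\<exists>S\<in>range ?S. \<forall>T\<in>range ?S. factors_through FA X S T \<longrightarrow> factors_through FA X T S"
    using X inclusion_subobject[OF XO sub] unfolding noetherian_object_def
    by (elim conjE allE[of _ "range ?S"]) blast
  then obtain n where n: "\<And>m. factors_through FA X (?S n) (?S m) \<Longrightarrow> factors_through FA X (?S m) (?S n)"
    by auto
  have "N m t \<subseteq> N n t" if t: "t \<in> Ob A" for m t
  proof (cases "m \<le> n")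
    case True then show ?thesis using N t by (auto simp: chain_of_subfunctors_def)
  next
    case False
    then have "factors_through FA X (?S n) (?S m)"
      unfolding le using N by (auto simp: chain_of_subfunctors_def)
    from n[OF this] show ?thesis unfolding le using t by blast
  qed
  then show ?thesis by blast
qed

definition preimage where
  "preimage G f N = (\<lambda>t. {v \<in> carrier (omap G t). f t v \<in> N t})"

definition image_functor where
  "image_functor G f = (\<lambda>t. f t ` carrier (omap G t))"

lemma subfunctor_preimage:
  assumes G: "G \<in> Ob FA" and X: "X \<in> Ob FA" and f: "f \<in> Mor FA G X" and N: "subfunctor X N"
  shows "subfunctor G (preimage G f N)"
  unfolding subfunctor_def
proof (intro conjI ballI)
  fix t assume t: "t \<in> Ob A"
  interpret Gt: module K "omap G t" by (rule module_value[OF G t])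
  note lin = component_linear[OF f t]
  show "submodule (preimage G f N t) K (omap G t)"
    using submoduleD[OF module_value[OF X t] subfunctorD(1)[OF N t]] linear_mapsD[OF lin]
      linear_map_zero[OF Gt.module_axioms module_value[OF X t] lin]
    by (intro submoduleI' Gt.module_axioms) (auto simp: preimage_def)
next
  fix t t' u v assume "t \<in> Ob A" "t' \<in> Ob A" "u \<in> Mor A t t'" "v \<in> preimage G f N t"
  then show "mmap G t t' u v \<in> preimage G f N t'"
    using linear_mapsD(1)[OF mmap_linear[OF G]] component_natural[OF f] subfunctorD(2)[OF N]
    by (auto simp: preimage_def)
qed

lemma subfunctor_image:
  assumes G: "G \<in> Ob FA" and X: "X \<in> Ob FA" and f: "f \<in> Mor FA G X"
  shows "subfunctor X (image_functor G f)"
  unfolding subfunctor_def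
proof (intro conjI ballI)
  fix t assume t: "t \<in> Ob A"
  interpret Gt: module K "omap G t" by (rule module_value[OF G t])
  interpret Xt: module K "omap X t" by (rule module_value[OF X t])
  note lin = component_linear[OF f t]
  note z = linear_map_zero[OF Gt.module_axioms Xt.module_axioms lin]
  show "submodule (image_functor G f t) K (omap X t)"
  proof (rule submoduleI'[OF Xt.module_axioms])
    show "\<zero>\<^bsub>omap X t\<^esub> \<in> image_functor G f t"
      unfolding image_functor_def z[symmetric] by blast
  next
    fix a b assume "a \<in> image_functor G f t" "b \<in> image_functor G f t"
    then show "a \<oplus>\<^bsub>omap X t\<^esub> b \<in> image_functor G f t"
      by (auto simp: image_functor_def linear_mapsD(2)[OF lin, symmetric])
  next
    fix k a assume "k \<in> carrier K" "a \<in> image_functor G f t"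
    then show "k \<odot>\<^bsub>omap X t\<^esub> a \<in> image_functor G f t"
      by (auto simp: image_functor_def linear_mapsD(3)[OF lin, symmetric])
  qed (use linear_mapsD(1)[OF lin] in \<open>auto simp: image_functor_def\<close>)
next
  fix t t' u v assume "t \<in> Ob A" "t' \<in> Ob A" "u \<in> Mor A t t'" "v \<in> image_functor G f t"
  then show "mmap X t t' u v \<in> image_functor G f t'"
    using linear_mapsD(1)[OF mmap_linear[OF G]] component_natural[OF f, symmetric]
    by (auto simp: image_functor_def)
qed

text \<open>
  The preimages of a chain in \<open>X\<close> form a chain in the noetherian object \<open>G\<close>, and
  \<open>N \<inter> f(G)\<close> is the image of the preimage of \<open>N\<close>.
\<close>

lemma chains_stabilise_on_image:
  assumes G: "noetherian_object FA G" and X: "X \<in> Ob FA" and f: "f \<in> Mor FA G X"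
  shows "chains_stabilise_on X (image_functor G f)"
  unfolding chains_stabilise_on_def
proof (intro allI impI)
  fix N assume N: "chain_of_subfunctors X N"
  have GO: "G \<in> Ob FA" using G by (simp add: noetherian_object_def)
  have "chain_of_subfunctors G (\<lambda>n. preimage G f (N n))"
    using N subfunctor_preimage[OF GO X f] unfolding chain_of_subfunctors_def
    by (auto simp: preimage_def subset_iff)
  from noetherian_chain[OF G this] obtain n
    where "\<forall>m. \<forall>t\<in>Ob A. preimage G f (N m) t \<subseteq> preimage G f (N n) t" by blast
  then have "\<forall>m. \<forall>t\<in>Ob A. N m t \<inter> image_functor G f t \<subseteq> N n t"
    by (auto simp: preimage_def image_functor_def subset_iff)
  then show "\<exists>n. \<forall>m. \<forall>t\<in>Ob A. N m t \<inter> image_functor G f t \<subseteq> N n t" by blast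
qed

definition sum_functor where
  "sum_functor X B C = (\<lambda>t. {b \<oplus>\<^bsub>omap X t\<^esub> c | b c. b \<in> B t \<and> c \<in> C t})"

lemma subfunctor_sum:
  assumes X: "X \<in> Ob FA" and B: "subfunctor X B" and C: "subfunctor X C"
  shows "subfunctor X (sum_functor X B C)"
  unfolding subfunctor_def
proof (intro conjI ballI)
  fix t assume t: "t \<in> Ob A"
  interpret Xt: module K "omap X t" by (rule module_value[OF X t])
  note b = submoduleD[OF Xt.module_axioms subfunctorD(1)[OF B t]]
  note c = submoduleD[OF Xt.module_axioms subfunctorD(1)[OF C t]]
  show "submodule (sum_functor X B C t) K (omap X t)"
  proof (rule submoduleI'[OF Xt.module_axioms])
    show "\<zero>\<^bsub>omap X t\<^esub> \<in> sum_functor X B C t"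
      unfolding sum_functor_def using b(2) c(2) Xt.M.l_zero[OF Xt.M.zero_closed, symmetric] by blast
  next
    fix x y assume "x \<in> sum_functor X B C t" "y \<in> sum_functor X B C t"
    then obtain b1 c1 b2 c2 where 1: "b1 \<in> B t" "c1 \<in> C t" "b2 \<in> B t" "c2 \<in> C t"
      and 2: "x = b1 \<oplus>\<^bsub>omap X t\<^esub> c1" "y = b2 \<oplus>\<^bsub>omap X t\<^esub> c2" by (auto simp: sum_functor_def)
    have "x \<oplus>\<^bsub>omap X t\<^esub> y = (b1 \<oplus>\<^bsub>omap X t\<^esub> b2) \<oplus>\<^bsub>omap X t\<^esub> (c1 \<oplus>\<^bsub>omap X t\<^esub> c2)"
      using 1 2 b(1) c(1) by (simp add: Xt.M.a_ac)
    then show "x \<oplus>\<^bsub>omap X t\<^esub> y \<in> sum_functor X B C t"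
      unfolding sum_functor_def using 1 b(3) c(3) by blast
  next
    fix k x assume k: "k \<in> carrier K" and "x \<in> sum_functor X B C t"
    then obtain b1 c1 where 1: "b1 \<in> B t" "c1 \<in> C t"
      and 2: "x = b1 \<oplus>\<^bsub>omap X t\<^esub> c1" by (auto simp: sum_functor_def)
    have "k \<odot>\<^bsub>omap X t\<^esub> x = (k \<odot>\<^bsub>omap X t\<^esub> b1) \<oplus>\<^bsub>omap X t\<^esub> (k \<odot>\<^bsub>omap X t\<^esub> c1)"
      using 1 2 b(1) c(1) k by (simp add: Xt.smult_r_distr)
    then show "k \<odot>\<^bsub>omap X t\<^esub> x \<in> sum_functor X B C t"
      unfolding sum_functor_def using 1 b(5) c(5) k by blast
  qed (use b(1) c(1) in \<open>auto simp: sum_functor_def\<close>)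
next
  fix t t' u v assume t: "t \<in> Ob A" "t' \<in> Ob A" "u \<in> Mor A t t'" and "v \<in> sum_functor X B C t"
  then obtain b c where 1: "b \<in> B t" "c \<in> C t" "v = b \<oplus>\<^bsub>omap X t\<^esub> c" by (auto simp: sum_functor_def)
  have "mmap X t t' u v = mmap X t t' u b \<oplus>\<^bsub>omap X t'\<^esub> mmap X t t' u c"
    unfolding 1(3) using 1 subfunctor_carrier[OF X B t(1)] subfunctor_carrier[OF X C t(1)]
    by (intro linear_mapsD(2)[OF mmap_linear[OF X t]]) auto
  then show "mmap X t t' u v \<in> sum_functor X B C t'"
    unfolding sum_functor_def using 1 subfunctorD(2)[OF B t] subfunctorD(2)[OF C t] by blast
qed

lemma sum_functor_upper:
  assumes X: "X \<in> Ob FA" and B: "subfunctor X B" and C: "subfunctor X C" and t: "t \<in> Ob A"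
  shows "B t \<subseteq> sum_functor X B C t" "C t \<subseteq> sum_functor X B C t"
proof -
  interpret Xt: module K "omap X t" by (rule module_value[OF X t])
  note b = submoduleD[OF Xt.module_axioms subfunctorD(1)[OF B t]]
  note c = submoduleD[OF Xt.module_axioms subfunctorD(1)[OF C t]]
  show "B t \<subseteq> sum_functor X B C t"
    unfolding sum_functor_def using b(1) c(2) Xt.M.r_zero[symmetric] by blast
  show "C t \<subseteq> sum_functor X B C t"
    unfolding sum_functor_def using c(1) b(2) Xt.M.l_zero[symmetric] by blast
qed

text \<open>
  This is the usual argument that an extension of noetherian objects is noetherian, phrased inside
  \<open>X\<close>: for an ascending chain \<open>N\<close>, both the intersections of \<open>N n\<close> with \<open>B\<close> and those of
  \<open>B + N n\<close> with \<open>C\<close> stabilise, and together these determine the intersection of \<open>N n\<close> with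
  \<open>B + C\<close>.
\<close>

lemma chains_stabilise_on_sum:
  assumes X: "X \<in> Ob FA" and B: "subfunctor X B" and C: "subfunctor X C"
    and gB: "chains_stabilise_on X B" and gC: "chains_stabilise_on X C"
  shows "chains_stabilise_on X (sum_functor X B C)"
  unfolding chains_stabilise_on_def
proof (intro allI impI)
  fix N assume N: "chain_of_subfunctors X N"
  have sub: "subfunctor X (N n)" for n using N by (simp add: chain_of_subfunctors_def)
  have mono: "v \<in> N n t" if "v \<in> N m t" "m \<le> n" "t \<in> Ob A" for m n t v
    using N that unfolding chain_of_subfunctors_def by blast
  have "chain_of_subfunctors X (\<lambda>n. sum_functor X B (N n))"
    using subfunctor_sum[OF X B sub] mono unfolding chain_of_subfunctors_def
    by (auto simp: sum_functor_def) blast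
  with gC obtain nC where nC: "\<And>m t. t \<in> Ob A \<Longrightarrow> sum_functor X B (N m) t \<inter> C t \<subseteq> sum_functor X B (N nC) t"
    unfolding chains_stabilise_on_def by blast
  obtain nB where nB: "\<And>m t. t \<in> Ob A \<Longrightarrow> N m t \<inter> B t \<subseteq> N nB t"
    using gB N unfolding chains_stabilise_on_def by blast
  \<comment> \<open>Write \<open>v = x + y\<close> and replace \<open>y\<close> by an element of \<open>B + N nC\<close>. Modulo \<open>N nC\<close>, this moves \<open>v\<close>
    into \<open>B\<close>, where \<open>nB\<close> bounds the chain.\<close>
  have "v \<in> N (max nB nC) t" if t: "t \<in> Ob A" and v: "v \<in> N m t" "v \<in> sum_functor X B C t" for m t v
  proof -
    interpret Xt: module K "omap X t" by (rule module_value[OF X t])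
    note b = submoduleD[OF Xt.module_axioms subfunctorD(1)[OF B t]]
    note n = submoduleD[OF Xt.module_axioms subfunctorD(1)[OF sub t]]
    obtain x y where xy: "x \<in> B t" "y \<in> C t" "v = x \<oplus>\<^bsub>omap X t\<^esub> y"
      using v(2) by (auto simp: sum_functor_def)
    note car = b(1)[OF xy(1)] subfunctor_carrier[OF X C t xy(2)]
    have "y = \<ominus>\<^bsub>omap X t\<^esub> x \<oplus>\<^bsub>omap X t\<^esub> v"
      using xy(3) car by (simp add: Xt.M.r_neg1)
    then have "y \<in> sum_functor X B (N m) t"
      unfolding sum_functor_def using b(4)[OF xy(1)] v(1) by blast
    then have "y \<in> sum_functor X B (N nC) t" using nC[OF t, of m] xy(2) by blast
    then obtain x' v' where x'v': "x' \<in> B t" "v' \<in> N nC t" "y = x' \<oplus>\<^bsub>omap X t\<^esub> v'"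
      unfolding sum_functor_def by blast
    note car' = b(1)[OF x'v'(1)] n(1)[OF x'v'(2)]
    define w where "w = x \<oplus>\<^bsub>omap X t\<^esub> x'"
    have w: "w \<in> B t" unfolding w_def using b(3) xy x'v' by blast
    have vw: "v = w \<oplus>\<^bsub>omap X t\<^esub> v'"
      unfolding w_def xy(3) x'v'(3) using car car' by (simp add: Xt.M.a_assoc)
    have "w = v \<oplus>\<^bsub>omap X t\<^esub> \<ominus>\<^bsub>omap X t\<^esub> v'"
      unfolding vw using b(1)[OF w] car' by (simp add: Xt.M.a_assoc Xt.M.r_neg)
    also have "\<dots> \<in> N (max m nC) t"
      using mono[OF v(1) _ t, of "max m nC"] mono[OF x'v'(2) _ t, of "max m nC"] n(3,4) by simp
    finally have "w \<in> N nB t" using nB[OF t] w by blast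
    then show ?thesis
      unfolding vw using mono[OF _ _ t, of w nB "max nB nC"] mono[OF x'v'(2) _ t, of "max nB nC"] n(3)
      by simp
  qed
  then show "\<exists>n. \<forall>m. \<forall>t\<in>Ob A. N m t \<inter> sum_functor X B C t \<subseteq> N n t" by blast
qed

text \<open>
  If all images of noetherian objects lie in \<open>N\<close>, then no morphism from a generator witnesses that
  \<open>N\<close> is a proper subobject.
\<close>

lemma whole_if_generators_factor:
  assumes gen: "locally_noetherian FA" and X: "X \<in> Ob FA" and N: "subfunctor X N"
    and im: "\<And>G f t v. noetherian_object FA G \<Longrightarrow> f \<in> Mor FA G X \<Longrightarrow> t \<in> Ob A \<Longrightarrow>
      v \<in> carrier (omap G t) \<Longrightarrow> f t v \<in> N t"
    and t: "t \<in> Ob A" and v: "v \<in> carrier (omap X t)"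
  shows "v \<in> N t"
proof -
  have "is_iso_mor FA (restriction X N) X (inclusion N)"
  proof (rule ccontr)
    assume "\<not> is_iso_mor FA (restriction X N) X (inclusion N)"
    then obtain G f where "noetherian_object FA G" "f \<in> Mor FA G X"
      "\<not> factors_through FA X (G, f) (restriction X N, inclusion N)"
      using gen X inclusion_subobject[OF X N]
      unfolding locally_noetherian_def generates_def by blast
    then show False
      using factors_through_inclusion_iff[OF X N] im by blast
  qed
  then obtain g where g: "g \<in> Mor FA X (restriction X N)"
    and eq: "cmp FA X (restriction X N) X (inclusion N) g = ident FA X"
    by (auto simp: is_iso_mor_def)
  have "g t v \<in> N t"
    using linear_mapsD(1)[OF component_linear[OF g t] v] by (simp add: restriction_def)
  with fun_cong[OF fun_cong[OF eq], of t v] show ?thesis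
    using t v by (simp add: cmp_FA ident_FA compose_def inclusion_def)
qed

text \<open>
  The subfunctors on which chains stabilise are closed under binary sums, so their union \<open>S\<close> is
  directed and hence a subfunctor. It contains the images of all noetherian objects and is therefore
  all of \<open>X\<close>. So the generator \<open>e\<close> lies in one of these subfunctors, which then equals \<open>X\<close>.
\<close>

lemma cyclic_functor_chain:
  assumes gen: "locally_noetherian FA" and X: "X \<in> Ob FA"
    and s: "s \<in> Ob A" and e: "e \<in> carrier (omap X s)"
    and cyclic: "\<And>N t v. subfunctor X N \<Longrightarrow> e \<in> N s \<Longrightarrow> t \<in> Ob A \<Longrightarrow> v \<in> carrier (omap X t) \<Longrightarrow> v \<in> N t"
    and N: "chain_of_subfunctors X N"
  shows "\<exists>n. \<forall>m. \<forall>t\<in>Ob A. N m t \<subseteq> N n t"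
proof -
  let ?good = "\<lambda>B. subfunctor X B \<and> chains_stabilise_on X B"
  define S where "S = (\<lambda>t. {v. \<exists>B. ?good B \<and> v \<in> B t})"
  have SI: "v \<in> S t" if "subfunctor X B" "chains_stabilise_on X B" "v \<in> B t" for B t v
    using that unfolding S_def by blast
  have directed: "\<exists>D. ?good D \<and> a \<in> D t \<and> b \<in> D t" if "t \<in> Ob A" "a \<in> S t" "b \<in> S t" for t a b
  proof -
    obtain B C where B: "subfunctor X B" "chains_stabilise_on X B" "a \<in> B t"
      and C: "subfunctor X C" "chains_stabilise_on X C" "b \<in> C t"
      using \<open>a \<in> S t\<close> \<open>b \<in> S t\<close> by (auto simp: S_def)
    show ?thesis
      using subfunctor_sum[OF X B(1) C(1)] chains_stabilise_on_sum[OF X B(1) C(1) B(2) C(2)]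
        sum_functor_upper[OF X B(1) C(1) that(1)] B(3) C(3) by blast
  qed
  have zero: "?good (\<lambda>t. {\<zero>\<^bsub>omap X t\<^esub>})"
  proof
    have "submodule {\<zero>\<^bsub>omap X t\<^esub>} K (omap X t)" if t: "t \<in> Ob A" for t
    proof -
      interpret Xt: module K "omap X t" by (rule module_value[OF X t])
      show ?thesis by (rule submoduleI'[OF Xt.module_axioms]) auto
    qed
    then show "subfunctor X (\<lambda>t. {\<zero>\<^bsub>omap X t\<^esub>})"
      using linear_map_zero[OF module_value[OF X] module_value[OF X] mmap_linear[OF X]]
      by (simp add: subfunctor_def)
    show "chains_stabilise_on X (\<lambda>t. {\<zero>\<^bsub>omap X t\<^esub>})"
      using submoduleD(2)[OF module_value[OF X] subfunctorD(1)]
      by (auto simp: chains_stabilise_on_def chain_of_subfunctors_def)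
  qed
  have "subfunctor X S"
    unfolding subfunctor_def
  proof (intro conjI ballI)
    fix t assume t: "t \<in> Ob A"
    note sm = submoduleD[OF module_value[OF X t] subfunctorD(1)[OF _ t]]
    show "submodule (S t) K (omap X t)"
    proof (rule submoduleI'[OF module_value[OF X t]])
      fix a b assume "a \<in> S t" "b \<in> S t"
      from directed[OF t this] show "a \<oplus>\<^bsub>omap X t\<^esub> b \<in> S t" using sm(3) SI by blast
    qed (use zero sm SI in \<open>auto simp: S_def\<close>)
  next
    fix t t' u v assume "t \<in> Ob A" "t' \<in> Ob A" "u \<in> Mor A t t'" "v \<in> S t"
    then show "mmap X t t' u v \<in> S t'" using subfunctorD(2) unfolding S_def by blast
  qed
  moreover have "f t v \<in> S t" if "noetherian_object FA G" "f \<in> Mor FA G X" "t \<in> Ob A"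
    "v \<in> carrier (omap G t)" for G f t v
    using subfunctor_image[OF _ X that(2)] chains_stabilise_on_image[OF that(1) X that(2)] that
    by (intro SI[of "image_functor G f"]) (auto simp: noetherian_object_def image_functor_def)
  ultimately have "e \<in> S s"
    using whole_if_generators_factor[OF gen X _ _ s e] by blast
  then obtain B where B: "subfunctor X B" "chains_stabilise_on X B" "e \<in> B s"
    by (auto simp: S_def)
  obtain n where n: "\<And>m t. t \<in> Ob A \<Longrightarrow> N m t \<inter> B t \<subseteq> N n t"
    using B(2) N unfolding chains_stabilise_on_def by blast
  have "N m t \<subseteq> N n t" if t: "t \<in> Ob A" for m t
  proof
    fix v assume v: "v \<in> N m t"
    have "subfunctor X (N m)" using N by (simp add: chain_of_subfunctors_def)
    from subfunctor_carrier[OF X this t v] have "v \<in> B t" using cyclic[OF B(1,3) t] by blast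
    then show "v \<in> N n t" using n[OF t] v by blast
  qed
  then show ?thesis by blast
qed

end

section \<open>Free modules as spaces of measures\<close>

text \<open>
  The measure \<open>\<Sum> k \<delta>\<^sub>f\<close>, where \<open>(k, f)\<close> runs through a list. Lists as coefficient data make the
  operations of the span concatenation and mapping, and they bound its cardinality.
\<close>

fun dirac_combination :: "('u, 'z) ring_scheme \<Rightarrow> ('u \<times> 'm) list \<Rightarrow> 'm set \<Rightarrow> 'u" where
  "dirac_combination K [] = (\<lambda>S. \<zero>\<^bsub>K\<^esub>)"
| "dirac_combination K ((k, f) # l) = (\<lambda>S. (if f \<in> S then k else \<zero>\<^bsub>K\<^esub>) \<oplus>\<^bsub>K\<^esub> dirac_combination K l S)"

definition dirac_span :: "('u, 'z) ring_scheme \<Rightarrow> 'm set \<Rightarrow> ('m set \<Rightarrow> 'u) set" where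
  "dirac_span K U = dirac_combination K ` lists (carrier K \<times> U)"

definition measure_module :: "('u, 'z) ring_scheme \<Rightarrow> 'm set \<Rightarrow> ('u, 'm set \<Rightarrow> 'u) module" where
  "measure_module K U =
     \<lparr>carrier = dirac_span K U, mult = undefined, one = undefined,
      ring.zero = (\<lambda>S. \<zero>\<^bsub>K\<^esub>), add = (\<lambda>\<mu> \<nu> S. \<mu> S \<oplus>\<^bsub>K\<^esub> \<nu> S), smult = (\<lambda>k \<mu> S. k \<otimes>\<^bsub>K\<^esub> \<mu> S)\<rparr>"

context cring
begin

lemma dirac_combination_closed:
  "l \<in> lists (carrier R \<times> U) \<Longrightarrow> dirac_combination R l S \<in> carrier R"
  by (induction l) auto

lemma dirac_span_closed: "\<mu> \<in> dirac_span R U \<Longrightarrow> \<mu> S \<in> carrier R"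
  by (auto simp: dirac_span_def intro: dirac_combination_closed)

lemma dirac_combination_append:
  assumes "l \<in> lists (carrier R \<times> U)" "l' \<in> lists (carrier R \<times> U)"
  shows "dirac_combination R (l @ l') = (\<lambda>S. dirac_combination R l S \<oplus> dirac_combination R l' S)"
  using assms(1)
proof (induction l)
  case Nil
  then show ?case using dirac_combination_closed[OF assms(2)] by simp
next
  case (Cons a l)
  then show ?case
    using dirac_combination_closed[OF assms(2)] dirac_combination_closed[of l U]
    by (auto simp: a_assoc)
qed

lemma dirac_combination_scale:
  assumes "l \<in> lists (carrier R \<times> U)" "k \<in> carrier R"
  shows "dirac_combination R (map (map_prod ((\<otimes>) k) id) l) = (\<lambda>S. k \<otimes> dirac_combination R l S)"
  using assms(1)
proof (induction l)
  case (Cons a l)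
  then show ?case
    using dirac_combination_closed[of l U] assms(2) by (auto simp: r_distr fun_eq_iff)
qed (use assms(2) in auto)

lemma dirac_span_zero: "(\<lambda>S. \<zero>) \<in> dirac_span R U"
  unfolding dirac_span_def by (rule image_eqI[of _ _ "[]"]) auto

lemma dirac_span_add:
  assumes "\<mu> \<in> dirac_span R U" "\<nu> \<in> dirac_span R U"
  shows "(\<lambda>S. \<mu> S \<oplus> \<nu> S) \<in> dirac_span R U"
proof -
  obtain l l' where "l \<in> lists (carrier R \<times> U)" "l' \<in> lists (carrier R \<times> U)"
    "\<mu> = dirac_combination R l" "\<nu> = dirac_combination R l'"
    using assms by (auto simp: dirac_span_def)
  then show ?thesis
    unfolding dirac_span_def by (intro image_eqI[of _ _ "l @ l'"]) (auto simp: dirac_combination_append)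
qed

lemma dirac_span_smult:
  assumes "\<mu> \<in> dirac_span R U" "k \<in> carrier R"
  shows "(\<lambda>S. k \<otimes> \<mu> S) \<in> dirac_span R U"
proof -
  obtain l where l: "l \<in> lists (carrier R \<times> U)" "\<mu> = dirac_combination R l"
    using assms by (auto simp: dirac_span_def)
  have "map (map_prod ((\<otimes>) k) id) l \<in> lists (carrier R \<times> U)"
    using l(1) assms(2) by (induction l) auto
  then show ?thesis
    unfolding dirac_span_def l(2) dirac_combination_scale[OF l(1) assms(2), symmetric]
    by (rule imageI)
qed

lemma module_measures: "module R (measure_module R U)" (is "module R ?V")
proof -
  have c: "\<mu> S \<in> carrier R" if "\<mu> \<in> carrier ?V" for \<mu> S
    using that dirac_span_closed[of \<mu> U S] by (simp add: measure_module_def)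
  have "abelian_group ?V"
  proof (rule abelian_groupI)
    fix \<mu> assume \<mu>: "\<mu> \<in> carrier ?V"
    show "\<zero>\<^bsub>?V\<^esub> \<oplus>\<^bsub>?V\<^esub> \<mu> = \<mu>"
      using c[OF \<mu>] by (simp add: measure_module_def)
    have "(\<lambda>S. \<ominus> \<one> \<otimes> \<mu> S) \<oplus>\<^bsub>?V\<^esub> \<mu> = \<zero>\<^bsub>?V\<^esub>"
      using c[OF \<mu>] by (simp add: measure_module_def l_minus l_neg fun_eq_iff)
    moreover have "(\<lambda>S. \<ominus> \<one> \<otimes> \<mu> S) \<in> carrier ?V"
      using \<mu> dirac_span_smult[of \<mu> U "\<ominus> \<one>"] by (simp add: measure_module_def)
    ultimately show "\<exists>\<nu>\<in>carrier ?V. \<nu> \<oplus>\<^bsub>?V\<^esub> \<mu> = \<zero>\<^bsub>?V\<^esub>" by blast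
    fix \<nu> assume \<nu>: "\<nu> \<in> carrier ?V"
    show "\<mu> \<oplus>\<^bsub>?V\<^esub> \<nu> \<in> carrier ?V"
      using \<mu> \<nu> by (simp add: measure_module_def dirac_span_add)
    show "\<mu> \<oplus>\<^bsub>?V\<^esub> \<nu> = \<nu> \<oplus>\<^bsub>?V\<^esub> \<mu>"
      using a_comm[OF c[OF \<mu>] c[OF \<nu>]] by (simp add: measure_module_def)
    fix \<rho> assume \<rho>: "\<rho> \<in> carrier ?V"
    show "(\<mu> \<oplus>\<^bsub>?V\<^esub> \<nu>) \<oplus>\<^bsub>?V\<^esub> \<rho> = \<mu> \<oplus>\<^bsub>?V\<^esub> (\<nu> \<oplus>\<^bsub>?V\<^esub> \<rho>)"
      using a_assoc[OF c[OF \<mu>] c[OF \<nu>] c[OF \<rho>]] by (simp add: measure_module_def)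
  qed (simp add: measure_module_def dirac_span_zero)
  moreover have "k \<odot>\<^bsub>?V\<^esub> \<mu> \<in> carrier ?V" if "k \<in> carrier R" "\<mu> \<in> carrier ?V" for k \<mu>
    using that by (simp add: measure_module_def dirac_span_smult)
  moreover have "(k \<oplus> k') \<odot>\<^bsub>?V\<^esub> \<mu> = k \<odot>\<^bsub>?V\<^esub> \<mu> \<oplus>\<^bsub>?V\<^esub> k' \<odot>\<^bsub>?V\<^esub> \<mu>"
    "(k \<otimes> k') \<odot>\<^bsub>?V\<^esub> \<mu> = k \<odot>\<^bsub>?V\<^esub> (k' \<odot>\<^bsub>?V\<^esub> \<mu>)"
    if "k \<in> carrier R" "k' \<in> carrier R" "\<mu> \<in> carrier ?V" for k k' \<mu>
    using that(1,2) c[OF that(3)] by (simp_all add: measure_module_def l_distr m_assoc)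
  moreover have "k \<odot>\<^bsub>?V\<^esub> (\<mu> \<oplus>\<^bsub>?V\<^esub> \<nu>) = k \<odot>\<^bsub>?V\<^esub> \<mu> \<oplus>\<^bsub>?V\<^esub> k \<odot>\<^bsub>?V\<^esub> \<nu>"
    if "k \<in> carrier R" "\<mu> \<in> carrier ?V" "\<nu> \<in> carrier ?V" for k \<mu> \<nu>
    using that(1) c[OF that(2)] c[OF that(3)] by (simp add: measure_module_def r_distr)
  moreover have "\<one> \<odot>\<^bsub>?V\<^esub> \<mu> = \<mu>" if "\<mu> \<in> carrier ?V" for \<mu>
    using c[OF that] by (simp add: measure_module_def)
  ultimately show ?thesis using is_cring by (intro moduleI) auto
qed

text \<open>
  A combination of point masses in \<open>U\<close> vanishes on the complement of \<open>U\<close>, whereas \<open>\<delta>\<^sub>f\<close> does not if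
  \<open>f\<close> lies in that complement. This is the linear independence that is needed.
\<close>

lemma dirac_in_span_iff:
  assumes "\<one> \<noteq> \<zero>"
  shows "dirac_combination R [(\<one>, f)] \<in> dirac_span R U \<longleftrightarrow> f \<in> U"
proof
  assume "dirac_combination R [(\<one>, f)] \<in> dirac_span R U"
  then obtain l where l: "l \<in> lists (carrier R \<times> U)" "dirac_combination R [(\<one>, f)] = dirac_combination R l"
    by (auto simp: dirac_span_def)
  have "dirac_combination R l (- U) = \<zero>"
    using l(1) by (induction l) auto
  then have "dirac_combination R [(\<one>, f)] (- U) = \<zero>"
    unfolding l(2) .
  then show "f \<in> U"
    using assms by (cases "f \<in> U") auto
next
  assume "f \<in> U"
  then show "dirac_combination R [(\<one>, f)] \<in> dirac_span R U"
    unfolding dirac_span_def by (intro imageI) auto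
qed

end

lemma dirac_span_mono: "U \<subseteq> V \<Longrightarrow> dirac_span K U \<subseteq> dirac_span K V"
  unfolding dirac_span_def by (intro image_mono lists_mono) auto

text \<open>
  The span is a quotient of the set of lists over \<open>K \<times> U\<close>, and over an infinite set there are no more
  lists than elements.
\<close>

lemma dirac_span_embed:
  fixes K :: "'u ring" and \<phi> :: "'m \<Rightarrow> 'u"
  assumes inf: "infinite (UNIV :: 'u set)" and \<phi>: "inj_on \<phi> U"
  shows "\<exists>e :: ('m set \<Rightarrow> 'u) \<Rightarrow> 'u. inj_on e (dirac_span K U)"
proof -
  obtain L :: "'u list \<Rightarrow> 'u" where L: "bij L"
    using lists_infinite_bij_betw_types[OF inf] by blast
  obtain P :: "'u \<times> 'u \<Rightarrow> 'u" where P: "bij P"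
    using card_of_Times_same_infinite[OF inf] by (auto simp: card_of_ordIso[symmetric])
  let ?p = "P \<circ> map_prod id \<phi>"
  let ?d = "inv_into (lists (carrier K \<times> U)) (dirac_combination K)"
  have p: "inj_on ?p (carrier K \<times> U)"
    using map_prod_inj_on[OF inj_on_id2 \<phi>, of "carrier K"] inj_on_subset[OF bij_is_inj[OF P] subset_UNIV]
    unfolding id_def by (rule comp_inj_on)
  have "inj_on (map ?p) (lists (carrier K \<times> U))"
  proof (rule inj_onI)
    fix l l' assume l: "l \<in> lists (carrier K \<times> U)" "l' \<in> lists (carrier K \<times> U)"
      and eq: "map ?p l = map ?p l'"
    have "set l \<union> set l' \<subseteq> carrier K \<times> U" using l by (simp add: lists_eq_set)
    with eq show "l = l'" by (rule map_inj_on[OF _ inj_on_subset[OF p]])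
  qed
  then have c: "inj_on (L \<circ> map ?p) (lists (carrier K \<times> U))"
    using inj_on_subset[OF bij_is_inj[OF L] subset_UNIV] by (rule comp_inj_on)
  have "?d ` dirac_span K U \<subseteq> lists (carrier K \<times> U)"
    unfolding dirac_span_def by (rule image_subsetI) (rule inv_into_into)
  with c have "inj_on (L \<circ> map ?p) (?d ` dirac_span K U)" by (rule inj_on_subset)
  moreover have "inj_on ?d (dirac_span K U)"
    unfolding dirac_span_def by (rule inj_on_inv_into) (rule order_refl)
  ultimately have "inj_on ((L \<circ> map ?p) \<circ> ?d) (dirac_span K U)"
    by (rule comp_inj_on[rotated])
  then show ?thesis by blast
qed

text \<open>The module structure on \<open>e ` V\<close> that makes the injection \<open>e\<close> an isomorphism.\<close>

definition transport :: "('b \<Rightarrow> 'c) \<Rightarrow> ('a, 'b) module \<Rightarrow> ('a, 'c) module" where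
  "transport e V = (let d = inv_into (carrier V) e in
     \<lparr>carrier = e ` carrier V, mult = undefined, one = undefined, ring.zero = e \<zero>\<^bsub>V\<^esub>,
      add = (\<lambda>a b. e (d a \<oplus>\<^bsub>V\<^esub> d b)), smult = (\<lambda>k a. e (k \<odot>\<^bsub>V\<^esub> d a))\<rparr>)"

lemma transport_simps:
  assumes "inj_on e (carrier V)"
  shows "carrier (transport e V) = e ` carrier V"
    and "\<zero>\<^bsub>transport e V\<^esub> = e \<zero>\<^bsub>V\<^esub>"
    and "v \<in> carrier V \<Longrightarrow> w \<in> carrier V \<Longrightarrow> e v \<oplus>\<^bsub>transport e V\<^esub> e w = e (v \<oplus>\<^bsub>V\<^esub> w)"
    and "v \<in> carrier V \<Longrightarrow> k \<odot>\<^bsub>transport e V\<^esub> e v = e (k \<odot>\<^bsub>V\<^esub> v)"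
  using assms by (simp_all add: transport_def Let_def)

lemma module_transport:
  assumes "module K V" "inj_on e (carrier V)"
  shows "module K (transport e V)"
proof -
  interpret V: module K V by fact
  note [simp] = transport_simps[OF assms(2)]
  show ?thesis
  proof (rule moduleI)
    show "cring K" by (rule V.R.is_cring)
    show "abelian_group (transport e V)"
    proof (rule abelian_groupI)
      fix a assume "a \<in> carrier (transport e V)"
      then obtain v where v: "v \<in> carrier V" "a = e v" by auto
      then have "e (\<ominus>\<^bsub>V\<^esub> v) \<oplus>\<^bsub>transport e V\<^esub> a = \<zero>\<^bsub>transport e V\<^esub>"
        by (simp add: V.M.l_neg)
      then show "\<exists>b\<in>carrier (transport e V). b \<oplus>\<^bsub>transport e V\<^esub> a = \<zero>\<^bsub>transport e V\<^esub>"
        using v by auto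
    next
      fix a b assume "a \<in> carrier (transport e V)" "b \<in> carrier (transport e V)"
      then show "a \<oplus>\<^bsub>transport e V\<^esub> b = b \<oplus>\<^bsub>transport e V\<^esub> a"
        using V.M.a_comm by auto
    qed (auto simp: V.M.a_assoc)
  qed (auto simp: V.smult_l_distr V.smult_r_distr V.smult_assoc1)
qed

section \<open>Linearised representable functors\<close>

text \<open>
  The functor \<open>K[A(s,-)]\<close>, coded by an injection \<open>e t\<close> of the span of the Dirac measures on
  \<open>A(s,t)\<close> into \<open>'u\<close> for each object \<open>t\<close>.
\<close>

locale free_functor = functors_to_vector_spaces A K
  for A :: "('o, 'm) category" and K :: "'u ring" +
  fixes s :: 'o and e :: "'o \<Rightarrow> ('m set \<Rightarrow> 'u) \<Rightarrow> 'u"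
  assumes s: "s \<in> Ob A"
    and code: "t \<in> Ob A \<Longrightarrow> inj_on (e t) (dirac_span K (Mor A s t))"
begin

interpretation K: cring K by (rule cring_K)

definition pushforward :: "'o \<Rightarrow> 'o \<Rightarrow> 'm \<Rightarrow> ('m set \<Rightarrow> 'u) \<Rightarrow> 'm set \<Rightarrow> 'u" where
  "pushforward t t' u \<mu> = (\<lambda>S. \<mu> {f \<in> Mor A s t. cmp A s t t' u f \<in> S})"

lemma pushforward_combination:
  assumes "l \<in> lists (carrier K \<times> Mor A s t)"
  shows "pushforward t t' u (dirac_combination K l) = dirac_combination K (map (map_prod id (cmp A s t t' u)) l)"
  using assms by (induction l) (auto simp: pushforward_def fun_eq_iff)

definition free :: "('o, 'm, ('u, 'u) module, 'u \<Rightarrow> 'u) cat_functor" where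
  "free = \<lparr>omap = (\<lambda>t. transport (e t) (measure_module K (Mor A s t))),
     mmap = (\<lambda>t t' u. \<lambda>a\<in>e t ` dirac_span K (Mor A s t).
        e t' (pushforward t t' u (inv_into (dirac_span K (Mor A s t)) (e t) a)))\<rparr>"

lemma pushforward_measures:
  assumes "\<And>f. f \<in> U \<Longrightarrow> cmp A s t t' u f \<in> U'" "U \<subseteq> Mor A s t" "\<mu> \<in> dirac_span K U"
  shows "pushforward t t' u \<mu> \<in> dirac_span K U'"
proof -
  obtain l where l: "l \<in> lists (carrier K \<times> U)" "\<mu> = dirac_combination K l"
    using assms(3) by (auto simp: dirac_span_def)
  have "l \<in> lists (carrier K \<times> Mor A s t)" using l(1) assms(2) by auto
  note eq = pushforward_combination[OF this]
  have "map (map_prod id (cmp A s t t' u)) l \<in> lists (carrier K \<times> U')"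
    using l(1) assms(1) by (induction l) auto
  then show ?thesis
    unfolding dirac_span_def l(2) eq by (rule imageI)
qed

lemma carrier_free: "carrier (omap free t) = e t ` dirac_span K (Mor A s t)"
  by (simp add: free_def transport_def measure_module_def Let_def)

lemma free_simps:
  assumes "t \<in> Ob A"
  shows "\<zero>\<^bsub>omap free t\<^esub> = e t (\<lambda>S. \<zero>\<^bsub>K\<^esub>)"
    and "\<mu> \<in> dirac_span K (Mor A s t) \<Longrightarrow> \<nu> \<in> dirac_span K (Mor A s t) \<Longrightarrow>
      e t \<mu> \<oplus>\<^bsub>omap free t\<^esub> e t \<nu> = e t (\<lambda>S. \<mu> S \<oplus>\<^bsub>K\<^esub> \<nu> S)"
    and "\<mu> \<in> dirac_span K (Mor A s t) \<Longrightarrow> k \<odot>\<^bsub>omap free t\<^esub> e t \<mu> = e t (\<lambda>S. k \<otimes>\<^bsub>K\<^esub> \<mu> S)"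
    and "\<mu> \<in> dirac_span K (Mor A s t) \<Longrightarrow> mmap free t t' u (e t \<mu>) = e t' (pushforward t t' u \<mu>)"
  using code[OF assms] by (simp_all add: free_def transport_def measure_module_def Let_def)

lemma cmp_Mor:
  "t \<in> Ob A \<Longrightarrow> t' \<in> Ob A \<Longrightarrow> u \<in> Mor A t t' \<Longrightarrow> f \<in> Mor A s t \<Longrightarrow> cmp A s t t' u f \<in> Mor A s t'"
  using category s by (simp add: is_category_def)

lemma module_free: "t \<in> Ob A \<Longrightarrow> module K (omap free t)"
  unfolding free_def
  using module_transport[OF K.module_measures, of "e t" "Mor A s t"] code
  by (simp add: measure_module_def)

lemma free_Ob: "free \<in> Ob FA"
proof -
  note pf = pushforward_measures[OF cmp_Mor order_refl]
  have 2: "mmap free t t' u \<in> linear_maps K (omap free t) (omap free t')"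
    if t: "t \<in> Ob A" "t' \<in> Ob A" "u \<in> Mor A t t'" for t t' u
  proof -
    have "mmap free t t' u \<in> extensional (carrier (omap free t))"
      by (simp add: carrier_free) (simp add: free_def)
    moreover have "mmap free t t' u \<in> carrier (omap free t) \<rightarrow> carrier (omap free t')"
      using pf[OF t] by (auto simp: carrier_free free_simps[OF t(1)])
    moreover have "mmap free t t' u (v \<oplus>\<^bsub>omap free t\<^esub> w)
        = mmap free t t' u v \<oplus>\<^bsub>omap free t'\<^esub> mmap free t t' u w"
      if "v \<in> carrier (omap free t)" "w \<in> carrier (omap free t)" for v w
      using that
      by (auto simp: carrier_free free_simps[OF t(1)] free_simps[OF t(2)] pf[OF t] K.dirac_span_add)
         (simp add: pushforward_def)
    moreover have "mmap free t t' u (k \<odot>\<^bsub>omap free t\<^esub> v) = k \<odot>\<^bsub>omap free t'\<^esub> mmap free t t' u v"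
      if "k \<in> carrier K" "v \<in> carrier (omap free t)" for k v
      using that
      by (auto simp: carrier_free free_simps[OF t(1)] free_simps[OF t(2)] pf[OF t] K.dirac_span_smult)
         (simp add: pushforward_def)
    ultimately show ?thesis by (auto simp: linear_maps_def PiE_def)
  qed
  have 3: "mmap free t t (ident A t) = (\<lambda>v\<in>carrier (omap free t). v)" if t: "t \<in> Ob A" for t
  proof
    fix v
    show "mmap free t t (ident A t) v = (\<lambda>v\<in>carrier (omap free t). v) v"
    proof (cases "v \<in> carrier (omap free t)")
      case True
      then obtain l where l: "l \<in> lists (carrier K \<times> Mor A s t)" "v = e t (dirac_combination K l)"
        by (auto simp: carrier_free dirac_span_def)
      have "map (map_prod id (cmp A s t t (ident A t))) l = l"
        using l(1) category s t by (intro map_idI) (auto simp: is_category_def in_lists_conv_set)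
      then have "pushforward t t (ident A t) (dirac_combination K l) = dirac_combination K l"
        by (simp add: pushforward_combination[OF l(1)])
      then show ?thesis
        using True l by (simp add: free_simps[OF t] dirac_span_def)
    next
      case False
      then show ?thesis by (simp add: carrier_free) (simp add: free_def)
    qed
  qed
  have 4: "mmap free x z (cmp A x y z g f) = compose (carrier (omap free x)) (mmap free y z g) (mmap free x y f)"
    if t: "x \<in> Ob A" "y \<in> Ob A" "z \<in> Ob A" "f \<in> Mor A x y" "g \<in> Mor A y z" for x y z f g
  proof
    fix v
    show "mmap free x z (cmp A x y z g f) v
        = compose (carrier (omap free x)) (mmap free y z g) (mmap free x y f) v"
    proof (cases "v \<in> carrier (omap free x)")
      case True
      then obtain \<mu> where \<mu>: "\<mu> \<in> dirac_span K (Mor A s x)" "v = e x \<mu>"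
        by (auto simp: carrier_free)
      \<comment> \<open>The two pushforwards measure the same preimage of \<open>S\<close>.\<close>
      have "{h \<in> Mor A s x. cmp A s x z (cmp A x y z g f) h \<in> S}
          = {h \<in> Mor A s x. cmp A s x y f h \<in> Mor A s y \<and> cmp A s y z g (cmp A s x y f h) \<in> S}" for S
        using category s t cmp_Mor[OF t(1,2,4)] by (auto simp: is_category_def)
      then have "pushforward x z (cmp A x y z g f) \<mu> = pushforward y z g (pushforward x y f \<mu>)"
        by (simp add: pushforward_def)
      then show ?thesis
        using True \<mu> pf[OF t(1,2,4)] t by (simp add: free_simps compose_def)
    next
      case False
      then show ?thesis by (simp add: carrier_free compose_def) (simp add: free_def)
    qed
  qed
  show ?thesis
    using module_free 2 3 4 by (simp add: Ob_FA is_functor_def Vect_def)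
qed

lemma subfunctor_measures:
  assumes U: "\<And>t. t \<in> Ob A \<Longrightarrow> U t \<subseteq> Mor A s t"
    and stable: "\<And>t t' u f. t \<in> Ob A \<Longrightarrow> t' \<in> Ob A \<Longrightarrow> u \<in> Mor A t t' \<Longrightarrow> f \<in> U t \<Longrightarrow>
      cmp A s t t' u f \<in> U t'"
  shows "subfunctor free (\<lambda>t. e t ` dirac_span K (U t))"
  unfolding subfunctor_def
proof (intro conjI ballI)
  fix t assume t: "t \<in> Ob A"
  have sub: "\<mu> \<in> dirac_span K (Mor A s t)" if "\<mu> \<in> dirac_span K (U t)" for \<mu>
    using dirac_span_mono[OF U[OF t]] that by blast
  show "submodule (e t ` dirac_span K (U t)) K (omap free t)"
    by (rule submoduleI'[OF module_free[OF t]])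
       (use sub in \<open>auto simp: carrier_free free_simps[OF t]
         intro!: imageI K.dirac_span_zero K.dirac_span_add K.dirac_span_smult\<close>)
next
  fix t t' u v assume t: "t \<in> Ob A" "t' \<in> Ob A" "u \<in> Mor A t t'" and "v \<in> e t ` dirac_span K (U t)"
  then show "mmap free t t' u v \<in> e t' ` dirac_span K (U t')"
    using pushforward_measures[OF stable[OF t] U[OF t(1)]]
      subsetD[OF dirac_span_mono[OF U[OF t(1)], of K]]
    by (auto simp: free_simps[OF t(1)])
qed

definition dirac :: "'o \<Rightarrow> 'm \<Rightarrow> 'u" where
  "dirac t f = e t (dirac_combination K [(\<one>\<^bsub>K\<^esub>, f)])"

lemma dirac_in_iff:
  assumes "t \<in> Ob A" "f \<in> Mor A s t" "U \<subseteq> Mor A s t"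
  shows "dirac t f \<in> e t ` dirac_span K U \<longleftrightarrow> f \<in> U"
proof -
  have 1: "\<one>\<^bsub>K\<^esub> \<noteq> \<zero>\<^bsub>K\<^esub>" using domain.one_not_zero[OF field.axioms(1)[OF field]] .
  have "dirac_combination K [(\<one>\<^bsub>K\<^esub>, f)] \<in> dirac_span K (Mor A s t)"
    by (rule iffD2[OF K.dirac_in_span_iff[OF 1] assms(2)])
  from inj_on_image_mem_iff[OF code[OF assms(1)] this dirac_span_mono[OF assms(3)]]
  have "dirac t f \<in> e t ` dirac_span K U \<longleftrightarrow> dirac_combination K [(\<one>\<^bsub>K\<^esub>, f)] \<in> dirac_span K U"
    unfolding dirac_def .
  then show ?thesis unfolding K.dirac_in_span_iff[OF 1] .
qed

text \<open>
  Half of the Yoneda lemma: \<open>\<delta>\<^sub>f\<close> is the image of the Dirac measure at the identity under \<open>f\<close>, and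
  the measures \<open>\<delta>\<^sub>f\<close> span.
\<close>

lemma free_cyclic:
  assumes N: "subfunctor free N" and gen: "dirac s (ident A s) \<in> N s"
    and t: "t \<in> Ob A" and v: "v \<in> carrier (omap free t)"
  shows "v \<in> N t"
proof -
  note sm = submoduleD[OF module_free[OF t] subfunctorD(1)[OF N t]]
  have id: "ident A s \<in> Mor A s s" using category s by (simp add: is_category_def)
  have *: "e t (dirac_combination K [(\<one>\<^bsub>K\<^esub>, f)]) \<in> N t" if f: "f \<in> Mor A s t" for f
  proof -
    have l: "[(\<one>\<^bsub>K\<^esub>, ident A s)] \<in> lists (carrier K \<times> Mor A s s)" using id by simp
    have "cmp A s s t f (ident A s) = f" using category s t f by (simp add: is_category_def)
    then have "mmap free s t f (dirac s (ident A s)) = e t (dirac_combination K [(\<one>\<^bsub>K\<^esub>, f)])"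
      unfolding dirac_def
      using free_simps(4)[OF s imageI[OF l, of "dirac_combination K", folded dirac_span_def]]
        pushforward_combination[OF l] by simp
    then show ?thesis using subfunctorD(2)[OF N s t f gen] by simp
  qed
  have "e t (dirac_combination K l) \<in> N t" if "l \<in> lists (carrier K \<times> Mor A s t)" for l
    using that
  proof (induction l)
    case Nil
    then show ?case using sm(2) by (simp add: free_simps[OF t])
  next
    case (Cons a l)
    obtain k f where a: "a = (k, f)" by (cases a)
    have kf: "k \<in> carrier K" "f \<in> Mor A s t" "l \<in> lists (carrier K \<times> Mor A s t)"
      using Cons.hyps by (simp_all add: a)
    let ?d = "dirac_combination K [(\<one>\<^bsub>K\<^esub>, f)]"
    have d: "?d \<in> dirac_span K (Mor A s t)" "dirac_combination K l \<in> dirac_span K (Mor A s t)"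
      unfolding dirac_span_def using kf by (auto intro!: imageI simp del: dirac_combination.simps)
    have "dirac_combination K (a # l) = (\<lambda>S. k \<otimes>\<^bsub>K\<^esub> ?d S \<oplus>\<^bsub>K\<^esub> dirac_combination K l S)"
      using kf by (auto simp: a fun_eq_iff)
    then have "e t (dirac_combination K (a # l)) = (k \<odot>\<^bsub>omap free t\<^esub> e t ?d) \<oplus>\<^bsub>omap free t\<^esub> e t (dirac_combination K l)"
      using free_simps(2)[OF t K.dirac_span_smult[OF d(1) kf(1)] d(2)] free_simps(3)[OF t d(1)] by simp
    also have "\<dots> \<in> N t"
      using sm(3)[OF sm(5)[OF kf(1) *[OF kf(2)]]] Cons.IH by blast
    finally show ?case .
  qed
  then show ?thesis using v by (auto simp: carrier_free dirac_span_def)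
qed

text \<open>
  The chain \<open>K[U n]\<close> in the cyclic functor \<open>K[A(s,-)]\<close> stabilises, and \<open>U n\<close> consists of those \<open>f\<close>
  whose Dirac measure lies in \<open>K[U n]\<close>.
\<close>

lemma set_subfunctor_chain:
  fixes U :: "nat \<Rightarrow> 'o \<Rightarrow> 'm set"
  assumes gen: "locally_noetherian FA"
    and U: "\<And>n t. t \<in> Ob A \<Longrightarrow> U n t \<subseteq> Mor A s t"
    and stable: "\<And>n t t' u f. t \<in> Ob A \<Longrightarrow> t' \<in> Ob A \<Longrightarrow> u \<in> Mor A t t' \<Longrightarrow> f \<in> U n t \<Longrightarrow>
      cmp A s t t' u f \<in> U n t'"
    and mono: "\<And>m n t. m \<le> n \<Longrightarrow> t \<in> Ob A \<Longrightarrow> U m t \<subseteq> U n t"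
  shows "\<exists>n. \<forall>m. \<forall>t\<in>Ob A. U m t \<subseteq> U n t"
proof -
  have chain: "chain_of_subfunctors free (\<lambda>n t. e t ` dirac_span K (U n t))"
    unfolding chain_of_subfunctors_def
  proof (intro conjI allI impI)
    show "subfunctor free (\<lambda>t. e t ` dirac_span K (U n t))" for n
      using U stable by (rule subfunctor_measures)
    show "e t ` dirac_span K (U m t) \<subseteq> e t ` dirac_span K (U n t)" if "m \<le> n" "t \<in> Ob A" for m n t
      using mono[OF that] by (intro image_mono dirac_span_mono)
  qed
  have id: "ident A s \<in> Mor A s s" using category s by (simp add: is_category_def)
  have "dirac s (ident A s) \<in> carrier (omap free s)"
    unfolding carrier_free dirac_in_iff[OF s id order_refl] by (rule id)
  have "\<exists>n. \<forall>m. \<forall>t\<in>Ob A. e t ` dirac_span K (U m t) \<subseteq> e t ` dirac_span K (U n t)"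
    by (rule cyclic_functor_chain[OF gen free_Ob s \<open>dirac s _ \<in> _\<close> _ chain]) (rule free_cyclic)
  then obtain n where
    n: "\<forall>m. \<forall>t\<in>Ob A. e t ` dirac_span K (U m t) \<subseteq> e t ` dirac_span K (U n t)"
    by (rule exE)
  have "U m t \<subseteq> U n t" if t: "t \<in> Ob A" for m t
  proof
    fix f assume f: "f \<in> U m t"
    then have fM: "f \<in> Mor A s t" using U[OF t] by blast
    have "dirac t f \<in> e t ` dirac_span K (U n t)"
      using n t dirac_in_iff[OF t fM U[OF t], of m] f by blast
    then show "f \<in> U n t" unfolding dirac_in_iff[OF t fM U[OF t]] .
  qed
  then show ?thesis by blast
qed

end

section \<open>Biproducts and the strictly increasing chain of graphs\<close>

text \<open>
  The morphism \<open>f p + g q\<close> restricts to \<open>f\<close> and \<open>g\<close> as soon as \<open>q i = 0\<close> and \<open>p j = 0\<close>. For the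
  first relation, composing \<open>i p + j q = 1\<close> with \<open>q\<close> gives \<open>q i p + q = q\<close>, hence \<open>q i p = 0\<close>, and
  \<open>i\<close> is then cancelled by means of \<open>p i = 1\<close>. The second one is symmetric.
\<close>

lemma biproduct_copairing:
  assumes pre: "is_preadditive A pl nul" and bi: "is_biproduct A pl x y s i j p q"
    and O: "x \<in> Ob A" "y \<in> Ob A" "t \<in> Ob A" and f: "f \<in> Mor A x t" and g: "g \<in> Mor A y t"
  shows "\<exists>w\<in>Mor A s t. cmp A x s t w i = f \<and> cmp A y s t w j = g"
proof -
  have cat: "is_category A" using pre by (simp add: is_preadditive_def)
  have s: "s \<in> Ob A" and m: "i \<in> Mor A x s" "j \<in> Mor A y s" "p \<in> Mor A s x" "q \<in> Mor A s y"
    and pi: "cmp A x s x p i = ident A x" and qj: "cmp A y s y q j = ident A y"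
    and sum: "pl s s (cmp A s x s i p) (cmp A s y s j q) = ident A s"
    using bi by (auto simp: is_biproduct_def)
  have c: "cmp A a b c g f \<in> Mor A a c"
    if "a \<in> Ob A" "b \<in> Ob A" "c \<in> Ob A" "f \<in> Mor A a b" "g \<in> Mor A b c" for a b c f g
    using cat that by (simp add: is_category_def)
  have as: "cmp A a b d h (cmp A a c b g f) = cmp A a c d (cmp A c b d h g) f"
    if "a \<in> Ob A" "c \<in> Ob A" "b \<in> Ob A" "d \<in> Ob A" "f \<in> Mor A a c" "g \<in> Mor A c b" "h \<in> Mor A b d" for a b c d f g h
    using cat that by (simp add: is_category_def)
  have idr: "cmp A a a b f (ident A a) = f" and idl: "cmp A a b b (ident A b) f = f"
    if "a \<in> Ob A" "b \<in> Ob A" "f \<in> Mor A a b" for a b f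
    using cat that by (simp_all add: is_category_def)
  have dl: "cmp A a b c g (pl a b f f') = pl a c (cmp A a b c g f) (cmp A a b c g f')"
    and dr: "cmp A a b c (pl b c g g') f = pl a c (cmp A a b c g f) (cmp A a b c g' f)"
    if "a \<in> Ob A" "b \<in> Ob A" "c \<in> Ob A" "f \<in> Mor A a b" "f' \<in> Mor A a b" "g \<in> Mor A b c" "g' \<in> Mor A b c"
    for a b c f f' g g'
    using pre that by (simp_all add: is_preadditive_def)
  have G: "comm_group \<lparr>carrier = Mor A a b, mult = pl a b, one = nul a b\<rparr>" if "a \<in> Ob A" "b \<in> Ob A" for a b
    using pre that by (simp add: is_preadditive_def)
  have plc: "pl a b f g \<in> Mor A a b" and plr: "pl a b f (nul a b) = f" and pll: "pl a b (nul a b) f = f"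
    and canc: "pl a b f g = f \<Longrightarrow> g = nul a b"
    and cancl: "pl a b g f = f \<Longrightarrow> g = nul a b"
    if "a \<in> Ob A" "b \<in> Ob A" "f \<in> Mor A a b" "g \<in> Mor A a b" for a b f g
  proof -
    interpret comm_group "\<lparr>carrier = Mor A a b, mult = pl a b, one = nul a b\<rparr>" by (rule G) fact+
    show "pl a b f g \<in> Mor A a b" "pl a b f (nul a b) = f" "pl a b (nul a b) f = f"
      using m_closed[of f g] r_one[of f] l_one[of f] that by auto
    show "pl a b f g = f \<Longrightarrow> g = nul a b" using r_cancel_one[of f g] l_cancel_one[of f g] that by auto
    show "pl a b g f = f \<Longrightarrow> g = nul a b" using r_cancel_one[of f g] l_cancel_one[of f g] that by auto
  qed
  have nl: "cmp A a b c (nul b c) f = nul a c" if "a \<in> Ob A" "b \<in> Ob A" "c \<in> Ob A" "f \<in> Mor A a b" for a b c f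
  proof -
    have N: "nul b c \<in> Mor A b c" using monoid.one_closed[OF group.is_monoid[OF comm_group.axioms(2)[OF G]]] that by force
    have "pl a c (cmp A a b c (nul b c) f) (cmp A a b c (nul b c) f) = cmp A a b c (nul b c) f"
      using dr[OF that(1-3,4,4) N N] pll[OF that(2,3) N N] by simp
    then show ?thesis using canc[OF that(1,3)] c[OF that(1-4) N] by blast
  qed
  have nr: "cmp A a b c g (nul a b) = nul a c" if "a \<in> Ob A" "b \<in> Ob A" "c \<in> Ob A" "g \<in> Mor A b c" for a b c g
  proof -
    have N: "nul a b \<in> Mor A a b" using monoid.one_closed[OF group.is_monoid[OF comm_group.axioms(2)[OF G]]] that by force
    have "pl a c (cmp A a b c g (nul a b)) (cmp A a b c g (nul a b)) = cmp A a b c g (nul a b)"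
      using dl[OF that(1-3) N N that(4,4)] pll[OF that(1,2) N N] by simp
    then show ?thesis using canc[OF that(1,3)] c[OF that(1-3) N that(4)] by blast
  qed
  note m' = c[OF O(1) s O(2) m(1,4)] c[OF O(2) s O(1) m(2,3)] c[OF s O(1) s m(3,1)] c[OF s O(2) s m(4,2)]
  have qi: "cmp A x s y q i = nul x y"
  proof -
    have "q = cmp A s s y q (pl s s (cmp A s x s i p) (cmp A s y s j q))"
      using sum idr[OF s O(2) m(4)] by simp
    also have "\<dots> = pl s y (cmp A s x y (cmp A x s y q i) p) (cmp A s y y (cmp A y s y q j) q)"
      using dl[OF s s O(2) m'(3,4) m(4,4)] as[OF s O(1) s O(2) m(3,1,4)] as[OF s O(2) s O(2) m(4,2,4)] by simp
    also have "\<dots> = pl s y (cmp A s x y (cmp A x s y q i) p) q" using qj idl[OF s O(2) m(4)] by simp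
    finally have "cmp A s x y (cmp A x s y q i) p = nul s y"
      using cancl[OF s O(2) m(4) c[OF s O(1,2) m(3) m'(1)]] by simp
    then have "cmp A x s y (nul s y) i = cmp A x x y (cmp A x s y q i) (cmp A x s x p i)"
      using as[OF O(1) s O(1,2) m(1,3) m'(1)] by simp
    then show ?thesis using nl[OF O(1) s O(2) m(1)] pi idr[OF O(1,2) m'(1)] by simp
  qed
  have pj: "cmp A y s x p j = nul y x"
  proof -
    have "p = cmp A s s x p (pl s s (cmp A s x s i p) (cmp A s y s j q))"
      using sum idr[OF s O(1) m(3)] by simp
    also have "\<dots> = pl s x (cmp A s x x (cmp A x s x p i) p) (cmp A s y x (cmp A y s x p j) q)"
      using dl[OF s s O(1) m'(3,4) m(3,3)] as[OF s O(1) s O(1) m(3,1,3)] as[OF s O(2) s O(1) m(4,2,3)] by simp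
    also have "\<dots> = pl s x p (cmp A s y x (cmp A y s x p j) q)" using pi idl[OF s O(1) m(3)] by simp
    finally have "cmp A s y x (cmp A y s x p j) q = nul s x"
      using canc[OF s O(1) m(3) c[OF s O(2,1) m(4) m'(2)]] by simp
    then have "cmp A y s x (nul s x) j = cmp A y y x (cmp A y s x p j) (cmp A y s y q j)"
      using as[OF O(2) s O(2,1) m(2,4) m'(2)] by simp
    then show ?thesis using nl[OF O(2) s O(1) m(2)] qj idr[OF O(2,1) m'(2)] by simp
  qed
  have fp: "cmp A s x t f p \<in> Mor A s t" and gq: "cmp A s y t g q \<in> Mor A s t"
    using c[OF s O(1,3) m(3) f] c[OF s O(2,3) m(4) g] .
  show ?thesis
  proof (intro bexI conjI)
    show "pl s t (cmp A s x t f p) (cmp A s y t g q) \<in> Mor A s t" by (rule plc[OF s O(3) fp gq])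
    have "cmp A x s t (pl s t (cmp A s x t f p) (cmp A s y t g q)) i
        = pl x t (cmp A x s t (cmp A s x t f p) i) (cmp A x s t (cmp A s y t g q) i)"
      by (rule dr[OF O(1) s O(3) m(1,1) fp gq])
    also have "\<dots> = pl x t f (nul x t)"
      using as[OF O(1) s O(1,3) m(1,3) f, symmetric] as[OF O(1) s O(2,3) m(1,4) g, symmetric]
        pi qi idr[OF O(1,3) f] nr[OF O(1,2,3) g] by simp
    finally show "cmp A x s t (pl s t (cmp A s x t f p) (cmp A s y t g q)) i = f"
      using plr[OF O(1,3) f f] by simp
    have "cmp A y s t (pl s t (cmp A s x t f p) (cmp A s y t g q)) j
        = pl y t (cmp A y s t (cmp A s x t f p) j) (cmp A y s t (cmp A s y t g q) j)"
      by (rule dr[OF O(2) s O(3) m(2,2) fp gq])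
    also have "\<dots> = pl y t (nul y t) g"
      using as[OF O(2) s O(1,3) m(2,3) f, symmetric] as[OF O(2) s O(2,3) m(2,4) g, symmetric]
        pj qj idr[OF O(2,3) g] nr[OF O(2,1,3) f] by simp
    finally show "cmp A y s t (pl s t (cmp A s x t f p) (cmp A s y t g q)) j = g"
      using pll[OF O(2,3) g g] by simp
  qed
qed

theorem proposition11p1:
  fixes A :: "('o, 'm) category"
    and K :: "'u ring"
  assumes "is_additive A"
    and "essentially_small TYPE('u) A"
    and "field K"
    and "locally_noetherian (functors_to_Vect A K)"
  shows "\<forall>x\<in>Ob A. \<forall>y\<in>Ob A. finite (Mor A x y)"
proof (intro ballI, rule ccontr)
  fix y x assume y: "y \<in> Ob A" and x: "x \<in> Ob A" and inf: "infinite (Mor A y x)"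
  obtain pl nul where pre: "is_preadditive A pl nul"
    and "\<forall>x\<in>Ob A. \<forall>y\<in>Ob A. \<exists>s i j p q. is_biproduct A pl x y s i j p q"
    using assms(1) by (auto simp: is_additive_def)
  then obtain s i j p q where bi: "is_biproduct A pl x y s i j p q"
    using x y by blast
  have cat: "is_category A" using pre by (simp add: is_preadditive_def)
  have s: "s \<in> Ob A" and ij: "i \<in> Mor A x s" "j \<in> Mor A y s"
    using bi by (auto simp: is_biproduct_def)
  obtain D :: "('u, 'u) category" and F where F: "is_equivalence A D F"
    using assms(2) by (auto simp: essentially_small_def)
  have inj: "inj_on (mmap F a b) (Mor A a b)" if "a \<in> Ob A" "b \<in> Ob A" for a b
    using F that by (auto simp: is_equivalence_def bij_betw_def)
  have infu: "infinite (UNIV :: 'u set)"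
    using inf finite_imageD[OF finite_subset[OF subset_UNIV] inj[OF y x]] by (rule contrapos_nn)
  have "\<forall>t\<in>Ob A. \<exists>c :: ('m set \<Rightarrow> 'u) \<Rightarrow> 'u. inj_on c (dirac_span K (Mor A s t))"
    using dirac_span_embed[OF infu inj[OF s]] by blast
  then obtain e :: "'o \<Rightarrow> ('m set \<Rightarrow> 'u) \<Rightarrow> 'u"
    where e: "\<And>t. t \<in> Ob A \<Longrightarrow> inj_on (e t) (dirac_span K (Mor A s t))" by metis
  interpret free_functor A K s e
    by (intro free_functor.intro functors_to_vector_spaces.intro free_functor_axioms.intro)
       (use cat assms(3) s e in auto)
  obtain \<gamma> :: "nat \<Rightarrow> 'm" where \<gamma>: "inj \<gamma>" "range \<gamma> \<subseteq> Mor A y x"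
    using infinite_countable_subset[OF inf] by blast
  have id: "ident A x \<in> Mor A x x" using cat x by (simp add: is_category_def)
  \<comment> \<open>\<open>w n\<close> is the pair \<open>(1, \<gamma> n)\<close>, which generates the graph of \<open>\<gamma> n\<close>, and \<open>U n\<close> is the union of the
    graphs of \<open>\<gamma> k\<close> for \<open>k < n\<close>.\<close>
  have "\<forall>n. \<exists>w\<in>Mor A s x. cmp A x s x w i = ident A x \<and> cmp A y s x w j = \<gamma> n"
    using biproduct_copairing[OF pre bi x y x id] \<gamma>(2) by blast
  then obtain w where w: "\<And>n. w n \<in> Mor A s x" "\<And>n. cmp A x s x (w n) i = ident A x"
      "\<And>n. cmp A y s x (w n) j = \<gamma> n" by metis
  define U where "U = (\<lambda>(n::nat) t. {cmp A s x t u (w k) | u k. u \<in> Mor A x t \<and> k < n})"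
  have "\<exists>n. \<forall>m. \<forall>t\<in>Ob A. U m t \<subseteq> U n t"
  proof (rule set_subfunctor_chain[OF assms(4)])
    fix n t t' u f assume t: "t \<in> Ob A" "t' \<in> Ob A" "u \<in> Mor A t t'" "f \<in> U n t"
    then obtain v k where v: "v \<in> Mor A x t" "k < n" "f = cmp A s x t v (w k)" by (auto simp: U_def)
    have "cmp A s t t' u f = cmp A s x t' (cmp A x t t' u v) (w k)" "cmp A x t t' u v \<in> Mor A x t'"
      using cat s x t v w(1) by (simp_all add: is_category_def)
    then show "cmp A s t t' u f \<in> U n t'" using v(2) by (auto simp: U_def)
  next
    fix n t assume "t \<in> Ob A"
    then show "U n t \<subseteq> Mor A s t" using cmp_Mor[OF x] w(1) cat s x by (auto simp: U_def is_category_def)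
  qed (auto simp: U_def intro: less_le_trans)
  then obtain n where n: "U (Suc n) x \<subseteq> U n x" using x by blast
  have "cmp A s x x (ident A x) (w n) = w n" using cat s x w(1) by (simp add: is_category_def)
  then have "w n \<in> U (Suc n) x" using id unfolding U_def by (auto intro!: exI[of _ "ident A x"] exI[of _ n])
  with n have "w n \<in> U n x" by (rule subsetD)
  then obtain u k where u: "u \<in> Mor A x x" and k: "k < n" and eq: "w n = cmp A s x x u (w k)"
    unfolding U_def by blast
  \<comment> \<open>Comparison of the first components of \<open>(1, \<gamma> n) = (u, u \<gamma> k)\<close> gives \<open>u = 1\<close>.\<close>
  have "ident A x = cmp A x s x (cmp A s x x u (w k)) i"
    using w(2)[of n] unfolding eq by (rule sym)
  also have "\<dots> = cmp A x x x u (cmp A x s x (w k) i)"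
    using cat s x ij(1) w(1)[of k] u by (simp add: is_category_def)
  also have "\<dots> = cmp A x x x u (ident A x)" unfolding w(2) ..
  also have "\<dots> = u" using cat x u by (simp add: is_category_def)
  finally have "w n = cmp A s x x (ident A x) (w k)" using eq by simp
  also have "\<dots> = w k" using cat s x w(1)[of k] by (simp add: is_category_def)
  finally have "w n = w k" .
  then have "\<gamma> n = \<gamma> k" using w(3)[of n] w(3)[of k] by simp
  then show False using injD[OF \<gamma>(1)] k by blast
qed

end
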